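(* Let $q\ge3$, let $g\in\mathbb{F}_q[t]$ be a non-constant square-free polynomial that is not a Carmichael polynomial, and let $\ell$ be a prime factor of $q-1$. Then there exist infinitely many cyclic extensions $K$ of $\mathbb{F}_q(t)$ of degree $\ell$ whose discriminants are relatively prime to $g$ such that $g$ is not Carmichael in $K$.
   Context: $\mathbb{F}_q$ is the finite field with $q$ elements. A finite ring $S$ is a Carmichael ring if $S$ is not a field and $a^{|S|}=a$ for every $a\in S$; an ideal $I$ of a ring $R$ is a Carmichael ideal if $R/I$ is a Carmichael ring. A polynomial $g\in\mathbb{F}_q[t]$ is a Carmichael polynomial if $(g)$ is a Carmichael ideal of $\mathbb{F}_q[t]$. For a finite extension $K$ of $\mathbb{F}_q(t)$, $\mathcal{O}_K$ denotes the integral closure of $\mathbb{F}_q[t]$ in $K$, and an element $\alpha\in\mathcal{O}_K$ is Carmichael in $K$ if $\alpha\mathcal{O}_K$ is a Carmichael ideal of $\mathcal{O}_K$. The discriminant of $K$ is the discriminant ideal of $\mathcal{O}_K$ over $\mathbb{F}_q[t]$; "relatively prime to $g$" means no irreducible factor of $g$ divides it. *)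

theory Defs
  imports "HOL-Algebra.QuotRing" "HOL-Algebra.RingHom"
    "HOL-Computational_Algebra.Polynomial" "HOL-Computational_Algebra.Fraction_Field"
    "HOL-Computational_Algebra.Squarefree" "HOL-Combinatorics.Permutations"
begin

definition carmichael_ring :: "('r, 'b) ring_scheme \<Rightarrow> bool" where
  "carmichael_ring S \<longleftrightarrow> finite (carrier S) \<and> \<not> field S \<and>
     (\<forall>a\<in>carrier S. a [^]\<^bsub>S\<^esub> card (carrier S) = a)"

definition carmichael_ideal :: "('r, 'b) ring_scheme \<Rightarrow> 'r set \<Rightarrow> bool" where
  "carmichael_ideal R I \<longleftrightarrow> carmichael_ring (R Quot I)"

definition poly_ring :: "'a::field poly ring" where
  "poly_ring = \<lparr>carrier = UNIV, monoid.mult = (*), one = 1, zero = 0, add = (+)\<rparr>"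

definition carmichael_poly :: "'a::field poly \<Rightarrow> bool" where
  "carmichael_poly g \<longleftrightarrow> carmichael_ideal poly_ring (PIdl\<^bsub>poly_ring\<^esub> g)"

text \<open>F_q(t) is the type 'a poly fract; a finite extension K of degree n is
  F_q(t)[X]/(h) with h irreducible of degree n, whose elements are represented by
  the remainders (polynomials of degree < n).\<close>

abbreviation emb :: "'a::field poly \<Rightarrow> 'a poly fract" where
  "emb a \<equiv> Fract a 1"

definition Kset :: "'a::field poly fract poly \<Rightarrow> 'a poly fract poly set" where
  "Kset h = {r. degree r < degree h}"

definition Kring :: "'a::field poly fract poly \<Rightarrow> 'a poly fract poly ring" where
  "Kring h = \<lparr>carrier = Kset h, monoid.mult = (\<lambda>x y. (x * y) mod h), one = 1,
              zero = 0, add = (+)\<rparr>"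

definition Kaut :: "'a::field poly fract poly \<Rightarrow> ('a poly fract poly \<Rightarrow> 'a poly fract poly) set" where
  "Kaut h = {\<sigma>. \<sigma> \<in> ring_iso (Kring h) (Kring h) \<and> \<sigma> \<in> extensional (Kset h) \<and>
                 (\<forall>c. \<sigma> [:c:] = [:c:])}"

text \<open>Cyclic extension of degree n: a field extension of degree n which is Galois
  (number of automorphisms = degree) with cyclic automorphism group.\<close>
definition cyclic_ext :: "nat \<Rightarrow> 'a::field poly fract poly \<Rightarrow> bool" where
  "cyclic_ext n h \<longleftrightarrow> irreducible h \<and> degree h = n \<and> card (Kaut h) = n \<and>
     (\<exists>\<sigma>\<in>Kaut h. \<forall>\<tau>\<in>Kaut h. \<exists>k. \<forall>x\<in>Kset h. \<tau> x = (\<sigma> ^^ k) x)"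

definition ext_iso :: "'a::field poly fract poly \<Rightarrow> 'a poly fract poly \<Rightarrow> bool" where
  "ext_iso h1 h2 \<longleftrightarrow> (\<exists>\<phi>\<in>ring_iso (Kring h1) (Kring h2). \<forall>c. \<phi> [:c:] = [:c:])"

definition OK :: "'a::field poly fract poly \<Rightarrow> 'a poly fract poly set" where
  "OK h = {x \<in> Kset h. \<exists>p :: 'a poly poly. lead_coeff p = 1 \<and>
             poly (map_poly (\<lambda>a. [:emb a:]) p) x mod h = 0}"

definition OK_ring :: "'a::field poly fract poly \<Rightarrow> 'a poly fract poly ring" where
  "OK_ring h = (Kring h)\<lparr>carrier := OK h\<rparr>"

text \<open>Trace of K over F_q(t): trace of multiplication by x w.r.t. the basis
  1, X, ..., X^(n-1).\<close>
definition Ktrace :: "'a::field poly fract poly \<Rightarrow> 'a poly fract poly \<Rightarrow> 'a poly fract" where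
  "Ktrace h x = (\<Sum>i<degree h. coeff ((x * monom 1 i) mod h) i)"

text \<open>Discriminant of an n-tuple: det (Tr(b_i b_j)), Leibniz formula.\<close>
definition Kdisc :: "'a::field poly fract poly \<Rightarrow> (nat \<Rightarrow> 'a poly fract poly) \<Rightarrow> 'a poly fract" where
  "Kdisc h b = (\<Sum>\<pi> | \<pi> permutes {..<degree h}. of_int (sign \<pi>) *
        (\<Prod>i<degree h. Ktrace h ((b i * b (\<pi> i)) mod h)))"

text \<open>Generators (in F_q[t]) of the discriminant ideal of O_K over F_q[t]: discriminants
  of n-tuples of elements of O_K.\<close>
definition disc_gens :: "'a::field poly fract poly \<Rightarrow> 'a poly set" where
  "disc_gens h = {d. \<exists>b. (\<forall>i<degree h. b i \<in> OK h) \<and> emb d = Kdisc h b}"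

text \<open>The discriminant (ideal) is relatively prime to g: no irreducible factor of g
  divides it (i.e. contains the ideal).\<close>
definition disc_coprime :: "'a::field poly fract poly \<Rightarrow> 'a poly \<Rightarrow> bool" where
  "disc_coprime h g \<longleftrightarrow> (\<forall>p. irreducible p \<and> p dvd g \<longrightarrow> \<not> (\<forall>d\<in>disc_gens h. p dvd d))"

definition carmichael_in :: "'a::field poly fract poly \<Rightarrow> 'a poly \<Rightarrow> bool" where
  "carmichael_in h g \<longleftrightarrow> carmichael_ideal (OK_ring h) (PIdl\<^bsub>OK_ring h\<^esub> [:emb g:])"

end

theory Submission
  imports "HOL-Algebra.Multiplicative_Group" "HOL-Number_Theory.Cong"
    "HOL-Computational_Algebra.Polynomial_Factorial" "HOL-Library.Cardinality" Defs
begin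

text \<open>
  Write $A = \mathbb{F}_q[t]$. Since $g$ is not Carmichael, Korselt's criterion yields a prime
  $p \mid g$ with $p = g$ or $\deg p \nmid \deg g$. Take the Kummer extension
  $K = \mathbb{F}_q(t)(\sqrt[l]{m})$ for an irreducible $m$ of degree greater than $\deg g$ that is
  not an $l$-th power modulo $p$; a Euclid-style argument shows that such $m$ exist in infinitely
  many degrees.

  As $m$ is irreducible, $\mathcal{O}_K = A[X]/(X^l - m)$: polynomials in $X$ over $A$ are roots of
  their characteristic polynomials, and if $x$ is integral, then the powers of $x$ have a common
  denominator, which the $q$-power maps, being diagonal on the powers of $X$, turn into one for
  the powers of each coefficient. The discriminant of $1, X, \dots, X^{l-1}$ is $\pm l^l m^{l-1}$,
  hence prime to $g$.

  The same diagonal maps show that $p$ is inert: their eigenvalues on $1, X, \dots, X^{l-1}$ are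
  distinct modulo $p$, so a nonzero ideal of $A[X]/(p, X^l - m)$ contains a monomial, that is, a
  unit. If $g = p$, then $\mathcal{O}_K/g$ is a field. Otherwise the Carmichael property would make
  the exponent $q^{l \deg g}$ act trivially on the field $\mathcal{O}_K/p$ with $q^{l \deg p}$
  elements, so that $\deg p \mid \deg g$.

  An isomorphism between two such fields forces $m_1 = c^l m_2^j$, which is impossible for distinct
  irreducibles, as $m_1$ divides the right-hand side with multiplicity divisible by $l$.
\<close>

section \<open>Polynomials\<close>

lemma irreducible_field_poly_degree_pos:
  fixes p :: "'a::field poly"
  assumes "irreducible p"
  shows "degree p > 0"
  using assms is_unit_iff_degree[of p] by (auto simp: irreducible_def)

lemma irreducible_dvd_imp_degree_eq:
  fixes m1 m2 :: "'a::field poly"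
  assumes "irreducible m1" "irreducible m2" "m1 dvd m2"
  shows "degree m1 = degree m2"
proof -
  have "m2 dvd m1" using assms by (meson irreducibleD' irreducible_not_unit)
  moreover have "m1 \<noteq> 0" "m2 \<noteq> 0" using assms(1,2) by auto
  ultimately show ?thesis using assms(3) by (intro antisym dvd_imp_degree_le)
qed

lemma field_poly_factorizationE:
  fixes a :: "'a::field poly"
  assumes "a \<noteq> 0"
  obtains c F where "c \<noteq> 0" "a = smult c (prod_mset F)" "\<And>p. p \<in># F \<Longrightarrow> irreducible p"
proof
  show "lead_coeff a \<noteq> 0" using assms by simp
  show "a = smult (lead_coeff a) (prod_mset (factorial_semiring.prime_factorization 0 (*) 1
      (\<lambda>p. smult (inverse (lead_coeff p)) p) a))"
    using assms by (simp add: field_poly_prod_mset_prime_factorization)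
qed (auto dest: field_poly_in_prime_factorization_imp_prime intro: prime_elem_imp_irreducible)

lemma field_poly_irreducible_divisorE:
  fixes a :: "'a::field poly"
  assumes "degree a > 0"
  obtains p where "irreducible p" "p dvd a"
proof -
  from assms have "a \<noteq> 0" by auto
  then obtain c F where factorization: "a = smult c (prod_mset F)" "\<And>p. p \<in># F \<Longrightarrow> irreducible p"
    by (rule field_poly_factorizationE) blast
  have "F \<noteq> {#}" using assms factorization(1) by (auto split: if_splits)
  then obtain p where "p \<in># F" by auto
  with factorization that show thesis by (meson dvd_prod_mset dvd_smult)
qed

lemma squarefree_field_poly_dvdI:
  fixes g a :: "'a::field poly"
  assumes "squarefree g" and irreducible_dvd: "\<And>p. irreducible p \<Longrightarrow> p dvd g \<Longrightarrow> p dvd a"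
  shows "g dvd a"
proof -
  have "g \<noteq> 0" using assms(1) by auto
  then obtain c F where factorization: "c \<noteq> 0" "g = smult c (prod_mset F)" "\<And>p. p \<in># F \<Longrightarrow> irreducible p"
    by (rule field_poly_factorizationE) blast
  have "squarefree (prod_mset F)"
    using assms(1) factorization(2) by (metis dvd_smult dvd_refl squarefree_mono)
  moreover have "irreducible p \<and> p dvd a" if "p \<in># F" for p
    using that factorization by (auto intro!: irreducible_dvd dvd_smult dvd_prod_mset)
  ultimately have "prod_mset F dvd a"
  proof (induction F)
    case (add p F)
    then have "squarefree (prod_mset F)" by (auto intro: squarefree_mono[of _ "p * prod_mset F"])
    then obtain b where cofactor: "a = prod_mset F * b" using add by auto
    have "\<not> p dvd prod_mset F"
    proof
      assume "p dvd prod_mset F"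
      then have "p\<^sup>2 dvd p * prod_mset F" by (simp add: power2_eq_square)
      then show False using add.prems by (auto dest: squarefreeD irreducible_not_unit)
    qed
    moreover have "prime_elem p" "p dvd prod_mset F * b"
      using add.prems cofactor by (auto intro: field_poly_irreducible_imp_prime)
    ultimately have "p dvd b" by (meson prime_elem_dvd_multD)
    then show ?case by (simp add: cofactor mult.commute mult_dvd_mono)
  qed simp
  then show ?thesis using factorization(1,2) by (simp add: smult_dvd)
qed

lemma prime_elem_dvd_prodE:
  fixes p :: "'b::algebraic_semidom"
  assumes "prime_elem p" "p dvd prod f I"
  obtains i where "i \<in> I" "p dvd f i"
proof (cases "finite I")
  case True
  then show thesis
    using assms that by (auto simp: prod_unfold_prod_mset elim!: prime_elem_dvd_prod_msetE)
qed (use assms in \<open>auto dest: prime_elem_not_unit\<close>)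

lemma
  fixes f g :: "'b::idom poly"
  assumes "lead_coeff g = 1"
  shows dvd_diff_pseudo_mod: "g dvd f - pseudo_mod f g"
    and pseudo_mod_eq_0_or_degree_less: "pseudo_mod f g = 0 \<or> degree (pseudo_mod f g) < degree g"
proof -
  have "g \<noteq> 0" using assms by auto
  moreover obtain q r where divmod: "pseudo_divmod f g = (q, r)" by fastforce
  ultimately have "f = g * q + r" "r = 0 \<or> degree r < degree g"
    using pseudo_divmod[of g f q r] assms by simp_all
  moreover have "pseudo_mod f g = r" by (simp add: pseudo_mod_def divmod)
  ultimately show "g dvd f - pseudo_mod f g" "pseudo_mod f g = 0 \<or> degree (pseudo_mod f g) < degree g"
    by auto
qed

lemma map_poly_hom_mult:
  fixes f :: "'b::comm_ring_1 \<Rightarrow> 'c::comm_ring_1"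
  assumes add: "\<And>x y. f (x + y) = f x + f y" and mult: "\<And>x y. f (x * y) = f x * f y"
  shows "map_poly f (p * q) = map_poly f p * map_poly f q"
proof (rule poly_eqI)
  fix n
  have zero: "f 0 = 0" using add[of 0 0] by simp
  have "f (sum g I) = (\<Sum>i\<in>I. f (g i))" for g :: "nat \<Rightarrow> 'b" and I
    by (induction I rule: infinite_finite_induct) (simp_all add: zero add)
  then show "coeff (map_poly f (p * q)) n = coeff (map_poly f p * map_poly f q) n"
    by (simp add: coeff_map_poly zero coeff_mult mult)
qed

lemma smult_sum_right: "smult a (sum f I) = (\<Sum>i\<in>I. smult a (f i))"
  by (induction I rule: infinite_finite_induct) (simp_all add: smult_add_right)

lemma poly_mod_sum: "sum f I mod h = (\<Sum>i\<in>I. f i mod h)" for h :: "'b::field poly"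
  by (induction I rule: infinite_finite_induct) (auto simp: poly_mod_add_left)

lemma poly_eq_sum_monom: "degree s < n \<Longrightarrow> (\<Sum>i<n. monom (coeff s i) i) = s"
  using poly_as_sum_of_monoms'[of s "n - 1"] by (cases n) (simp_all add: lessThan_Suc_atMost)

lemma pcompose_monom: "pcompose (monom c n) r = smult c (r ^ n)"
  by (induction n) (simp_all add: monom_0 monom_Suc pcompose_pCons)

section \<open>Polynomials over a field of fractions\<close>

lemma to_fract_power [simp]: "to_fract (x ^ n) = to_fract x ^ n"
  by (induction n) auto

lemma to_fract_prod [simp]: "to_fract (prod f I) = (\<Prod>i\<in>I. to_fract (f i))"
  by (induction I rule: infinite_finite_induct) auto

lemma to_fract_of_nat [simp]: "to_fract (of_nat n) = of_nat n"
  by (induction n) auto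

lemma CHAR_fract [simp]: "CHAR('b::idom fract) = CHAR('b)"
proof (rule CHAR_eqI)
  fix n assume "of_nat n = (0 :: 'b fract)"
  then have "to_fract (of_nat n :: 'b) = to_fract 0" by simp
  then show "CHAR('b) dvd n" by (simp only: to_fract_eq_iff of_nat_eq_0_iff_char_dvd)
qed (simp flip: to_fract_of_nat)

lemma coeff_fract_poly [simp]: "coeff (fract_poly s) i = to_fract (coeff s i)"
  by (simp add: coeff_map_poly)

lemma degree_fract_poly [simp]: "degree (fract_poly s) = degree s"
  by (rule degree_map_poly) simp

lemma fract_poly_uminus [simp]: "fract_poly (- s) = - fract_poly s"
  by (rule poly_eqI) simp

lemma fract_poly_power [simp]: "fract_poly (s ^ n) = fract_poly s ^ n"
  by (induction n) auto

lemma fract_poly_sum [simp]: "fract_poly (sum f I) = (\<Sum>i\<in>I. fract_poly (f i))"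
  by (induction I rule: infinite_finite_induct) auto

lemma fract_poly_pseudo_mod:
  assumes "lead_coeff g = 1"
  shows "fract_poly (pseudo_mod f g) = fract_poly f mod fract_poly g"
proof -
  have "fract_poly g dvd fract_poly f - fract_poly (pseudo_mod f g)"
    using fract_poly_dvd[OF dvd_diff_pseudo_mod[OF assms]] by simp
  then have "fract_poly f mod fract_poly g = fract_poly (pseudo_mod f g) mod fract_poly g"
    by (simp add: mod_eq_dvd_iff)
  also have "\<dots> = fract_poly (pseudo_mod f g)"
    using pseudo_mod_eq_0_or_degree_less[OF assms, of f] by (auto simp: mod_poly_less)
  finally show ?thesis ..
qed

definition int_eval :: "'a::field poly poly \<Rightarrow> 'a poly fract poly \<Rightarrow> 'a poly fract poly" where
  "int_eval p x = poly (map_poly (\<lambda>a. [:to_fract a:]) p) x"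

lemma int_eval_diff: "int_eval (p - r) x = int_eval p x - int_eval r x"
proof -
  have "map_poly (\<lambda>a. [:to_fract a:]) (p - r) =
      map_poly (\<lambda>a. [:to_fract a:]) p - map_poly (\<lambda>a. [:to_fract a:]) r"
    by (rule poly_eqI) (simp add: coeff_map_poly)
  then show ?thesis by (simp add: int_eval_def)
qed

lemma int_eval_mult: "int_eval (p * r) x = int_eval p x * int_eval r x"
  by (simp add: int_eval_def map_poly_hom_mult)

lemma int_eval_monom_1: "int_eval (monom 1 k) x = x ^ k"
  by (simp add: int_eval_def map_poly_monom poly_monom flip: one_pCons)

lemma int_eval_eq_sum: "degree p \<le> n \<Longrightarrow> int_eval p x = (\<Sum>i\<le>n. smult (to_fract (coeff p i)) (x ^ i))"
  unfolding int_eval_def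
  by (subst poly_altdef, rule sum.mono_neutral_cong_left)
    (auto simp: coeff_map_poly coeff_eq_0 degree_map_poly)

lemma fract_poly_common_denominatorE:
  fixes s :: "'b::idom fract poly"
  obtains d S where "d \<noteq> 0" "smult (to_fract d) s = fract_poly S"
proof -
  have "\<exists>d S. d \<noteq> 0 \<and> smult (to_fract d) s = fract_poly S"
  proof (induction s)
    case (pCons c s)
    then obtain d S where tail_denominator: "d \<noteq> 0" "smult (to_fract d) s = fract_poly S" by blast
    obtain a b where fraction: "c = to_fract a / to_fract b" "b \<noteq> 0"
      by (cases c) (auto simp: Fract_conv_to_fract)
    have "smult (to_fract (b * d)) (pCons c s) =
        pCons (to_fract (d * a)) (smult (to_fract b) (fract_poly S))"
      using fraction by (simp add: field_simps flip: tail_denominator(2))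
    also have "\<dots> = fract_poly (pCons (d * a) (smult b S))" by (simp add: map_poly_pCons)
    finally show ?case using fraction(2) tail_denominator(1) by (metis mult_eq_0_iff)
  qed (metis fract_poly_0 smult_0_right zero_neq_one)
  with that show thesis by blast
qed

lemma fract_poly_primitive_multipleE:
  fixes f :: "'a::field poly fract poly"
  assumes "f \<noteq> 0" "irreducible p"
  obtains c S where "c \<noteq> 0" "smult c f = fract_poly S" "\<not> [:p:] dvd S"
proof -
  let ?P = "\<lambda>S. \<exists>c. c \<noteq> 0 \<and> smult c f = fract_poly S"
  obtain d S0 where "d \<noteq> 0" "smult (to_fract d) f = fract_poly S0"
    by (rule fract_poly_common_denominatorE)
  then have "?P S0" using to_fract_eq_0_iff by blast
  then obtain S where "?P S" and minimal: "\<And>T. ?P T \<Longrightarrow> degree (lead_coeff S) \<le> degree (lead_coeff T)"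
    using arg_min_nat_lemma[of ?P S0 "\<lambda>S. degree (lead_coeff S)"] by blast
  then obtain c where multiple: "c \<noteq> 0" "smult c f = fract_poly S" by blast
  have "\<not> [:p:] dvd S"
  proof
    assume "[:p:] dvd S"
    then obtain T where S_eq: "S = smult p T" by auto
    have "p \<noteq> 0" using assms(2) by auto
    have "smult (c / to_fract p) f = smult (inverse (to_fract p)) (smult c f)"
      by (simp add: divide_inverse mult.commute)
    also have "\<dots> = fract_poly T" using \<open>p \<noteq> 0\<close> by (simp add: multiple(2) S_eq)
    finally have "?P T" using multiple(1) \<open>p \<noteq> 0\<close> by (intro exI[of _ "c / to_fract p"]) simp
    then have "degree (p * lead_coeff T) \<le> degree (lead_coeff T)"
      using minimal[of T] \<open>p \<noteq> 0\<close> by (simp add: S_eq)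
    moreover have "T \<noteq> 0" using multiple assms(1) S_eq by auto
    ultimately show False
      using \<open>p \<noteq> 0\<close> irreducible_field_poly_degree_pos[OF assms(2)] by (simp add: degree_mult_eq)
  qed
  with multiple that show thesis by blast
qed

lemma fract_lowest_termsE:
  fixes c :: "'a::field poly fract"
  obtains a b where "c = to_fract a / to_fract b" "b \<noteq> 0" "\<forall>p. irreducible p \<longrightarrow> p dvd b \<longrightarrow> \<not> p dvd a"
proof -
  let ?P = "\<lambda>b. b \<noteq> 0 \<and> (\<exists>a. to_fract b * c = to_fract a)"
  obtain a0 b0 where "c = Fract a0 b0" "b0 \<noteq> 0" by (cases c)
  then have "?P b0" by (auto simp: Fract_conv_to_fract)
  then obtain b where denominator: "?P b" and minimal: "\<And>b'. ?P b' \<Longrightarrow> degree b \<le> degree b'"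
    using arg_min_nat_lemma[of ?P b0 degree] by blast
  then obtain a where numerator: "to_fract b * c = to_fract a" by blast
  show thesis
  proof (rule that)
    show "c = to_fract a / to_fract b" using numerator denominator by (simp add: field_simps)
    show "\<forall>p. irreducible p \<longrightarrow> p dvd b \<longrightarrow> \<not> p dvd a"
    proof (intro allI impI notI)
      fix p assume prime_factor: "irreducible p" "p dvd b"
      assume "p dvd a"
      with prime_factor(2) obtain a' b' where cancelled: "a = p * a'" "b = p * b'" by (elim dvdE)
      with numerator denominator have "?P b'" by (auto simp: mult.assoc)
      then have "degree (p * b') \<le> degree b'" using minimal cancelled(2) by blast
      then show False
        using denominator cancelled(2) irreducible_field_poly_degree_pos[OF prime_factor(1)]
        by (simp add: degree_mult_eq)
    qed
  qed (use denominator in blast)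
qed

lemma non_integral_fractE:
  fixes c :: "'a::field poly fract"
  assumes "c \<notin> range to_fract"
  obtains a b p where "to_fract b * c = to_fract a" "irreducible p" "p dvd b" "\<not> p dvd a"
proof -
  obtain a b where lowest_terms: "c = to_fract a / to_fract b" "b \<noteq> 0"
      "\<forall>p. irreducible p \<longrightarrow> p dvd b \<longrightarrow> \<not> p dvd a"
    by (rule fract_lowest_termsE)
  have "degree b > 0"
  proof (rule ccontr)
    assume "\<not> degree b > 0"
    then have "b dvd a" using lowest_terms(2) by (meson is_unit_iff_degree neq0_conv unit_imp_dvd)
    then obtain d where "a = b * d" ..
    with lowest_terms have "c = to_fract d" by simp
    with assms show False by blast
  qed
  then obtain p where "irreducible p" "p dvd b" by (rule field_poly_irreducible_divisorE)
  with lowest_terms that[of b a p] show thesis by simp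
qed

lemma integral_fract_if_bounded_denominators:
  fixes c :: "'a::field poly fract"
  assumes "d \<noteq> 0" and bounded: "\<And>N. \<exists>n\<ge>N. to_fract d * c ^ n \<in> range to_fract"
  shows "c \<in> range to_fract"
proof (rule ccontr)
  assume "c \<notin> range to_fract"
  then obtain a b p where fraction: "to_fract b * c = to_fract a"
    and prime_factor: "irreducible p" "p dvd b" "\<not> p dvd a"
    by (rule non_integral_fractE)
  obtain n z where n_ge: "n \<ge> Suc (degree d)" and integral: "to_fract d * c ^ n = to_fract z"
    using bounded by (metis imageE)
  have "to_fract (d * a ^ n) = to_fract (b ^ n) * (to_fract d * c ^ n)"
    by (simp add: power_mult_distrib flip: fraction)
  also have "\<dots> = to_fract (b ^ n * z)" by (simp add: integral)
  finally have "d * a ^ n = b ^ n * z" by (simp only: to_fract_eq_iff)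
  then have "p ^ n dvd a ^ n * d" using prime_factor(2) by (simp add: dvd_power_same mult.commute)
  moreover have "prime_elem p" using prime_factor(1) by (rule field_poly_irreducible_imp_prime)
  ultimately have "p ^ n dvd d"
    using prime_factor(3) n_ge prime_power_dvd_multD[of p n "a ^ n" d]
    by (simp add: prime_elem_dvd_power_iff)
  then have "n * degree p \<le> degree d"
    using dvd_imp_degree_le[of "p ^ n" d] assms(1) prime_factor(1)
    by (subst (asm) degree_power_eq) auto
  also have "\<dots> < n" using n_ge by simp
  finally show False using irreducible_field_poly_degree_pos[OF prime_factor(1)] by simp
qed

lemma integral_fract_if_power_mult_irreducible:
  fixes c :: "'a::field poly fract"
  assumes "irreducible m" "i < n" and integral: "c ^ n * to_fract m ^ i \<in> range to_fract"
  shows "c \<in> range to_fract"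
proof (rule ccontr)
  assume "c \<notin> range to_fract"
  then obtain a b p where fraction: "to_fract b * c = to_fract a"
    and prime_factor: "irreducible p" "p dvd b" "\<not> p dvd a"
    by (rule non_integral_fractE)
  note prime = field_poly_irreducible_imp_prime[OF prime_factor(1)]
  obtain z where z_eq: "c ^ n * to_fract m ^ i = to_fract z" using integral by blast
  have "to_fract (a ^ n * m ^ i) = to_fract (b ^ n) * (c ^ n * to_fract m ^ i)"
    by (simp add: power_mult_distrib flip: fraction)
  also have "\<dots> = to_fract (b ^ n * z)" by (simp add: z_eq)
  finally have "a ^ n * m ^ i = b ^ n * z" by (simp only: to_fract_eq_iff)
  then have "p ^ n dvd a ^ n * m ^ i" using prime_factor(2) by (simp add: dvd_power_same)
  then have p_power_dvd: "p ^ n dvd m ^ i"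
    using prime prime_factor(3) assms(2) prime_power_dvd_multD[of p n "a ^ n" "m ^ i"]
    by (simp add: prime_elem_dvd_power_iff)
  moreover have "p dvd p ^ n" using assms(2) by (intro dvd_power) simp
  ultimately have "p dvd m" using prime by (meson dvd_trans prime_elem_dvd_power)
  then have "degree p = degree m"
    using irreducible_dvd_imp_degree_eq assms(1) prime_factor(1) by blast
  moreover have "m \<noteq> 0" "p \<noteq> 0" using assms(1) prime_factor(1) by auto
  ultimately have "n * degree p \<le> i * degree p"
    using dvd_imp_degree_le[OF p_power_dvd] by (simp add: degree_power_eq)
  then show False using assms(2) irreducible_field_poly_degree_pos[OF prime_factor(1)] by simp
qed

lemma irreducible_neq_power_mult_power:
  fixes m1 m2 :: "'a::field poly"
  assumes "irreducible m1" "\<not> m1 dvd m2" "n > 1"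
  shows "to_fract m1 \<noteq> c ^ n * to_fract m2 ^ j"
proof
  assume m1_eq: "to_fract m1 = c ^ n * to_fract m2 ^ j"
  note prime = field_poly_irreducible_imp_prime[OF assms(1)]
  obtain a b where lowest_terms: "c = to_fract a / to_fract b" "b \<noteq> 0"
      "\<forall>p. irreducible p \<longrightarrow> p dvd b \<longrightarrow> \<not> p dvd a"
    by (rule fract_lowest_termsE)
  have "to_fract (m1 * b ^ n) = to_fract (a ^ n * m2 ^ j)"
    using lowest_terms(2) by (simp add: m1_eq lowest_terms(1) power_divide)
  then have cleared: "m1 * b ^ n = a ^ n * m2 ^ j" by (simp only: to_fract_eq_iff)
  then have "m1 dvd a ^ n * m2 ^ j" by (metis dvd_triv_left)
  then have "m1 dvd a" using prime assms(2) by (meson prime_elem_dvd_multD prime_elem_dvd_power)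
  then have "m1 ^ n dvd m1 * b ^ n" by (simp add: cleared dvd_power_same)
  moreover have "m1 ^ n = m1 * m1 ^ (n - 1)" using assms(3) by (simp flip: power_Suc)
  ultimately have "m1 ^ (n - 1) dvd b ^ n" using prime by simp
  moreover have "m1 dvd m1 ^ (n - 1)" using assms(3) by (intro dvd_power) simp
  ultimately have "m1 dvd b" using prime by (meson dvd_trans prime_elem_dvd_power)
  with lowest_terms(3) assms(1) \<open>m1 dvd a\<close> show False by blast
qed

section \<open>Congruences between powers and roots of unity\<close>

lemma dvd_power_minus_one_mult:
  fixes d w :: "'b::comm_ring_1"
  assumes "d dvd w ^ n - 1"
  shows "d dvd w ^ (n * k) - 1"
proof (induction k)
  case (Suc k)
  have "w ^ (n * Suc k) - 1 = w ^ n * (w ^ (n * k) - 1) + (w ^ n - 1)"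
    by (simp add: power_add algebra_simps)
  with Suc assms show ?case by (metis dvd_add dvd_mult)
qed simp

lemma dvd_mult_power_minus_one_iff:
  fixes d x y :: "'b::comm_ring_1"
  assumes "d dvd y ^ n - 1"
  shows "d dvd (x * y) ^ n - 1 \<longleftrightarrow> d dvd x ^ n - 1"
proof -
  have split: "(x * y) ^ n - 1 = x ^ n * (y ^ n - 1) + (x ^ n - 1)"
    by (simp add: power_mult_distrib right_diff_distrib)
  show ?thesis unfolding split by (rule dvd_add_right_iff) (rule dvd_mult[OF assms])
qed

lemma dvd_power_minus_one_coprime:
  fixes d w :: "'b::comm_ring_1"
  assumes "d dvd w ^ n - 1" "d dvd w ^ k - 1" "coprime n k" "n \<noteq> 0"
  shows "d dvd w - 1"
proof -
  obtain x y where "n * x = k * y + gcd n k" using bezout_nat[OF assms(4)] by blast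
  then have "w ^ (n * x) = w ^ (k * y) * w" using assms(3) by simp
  then have "w - 1 = (w ^ (n * x) - 1) - (w ^ (k * y) - 1) * w" by (simp add: algebra_simps)
  then show ?thesis using assms dvd_power_minus_one_mult by (metis dvd_diff dvd_mult2)
qed

lemma dvd_power_diff_imp_dvd_minus_one:
  fixes d w :: "'b::comm_ring_1"
  assumes "prime l" "d dvd w ^ l - 1" "i < l" "j < l" "i \<noteq> j" "d dvd w ^ i - w ^ j"
  shows "d dvd w - 1"
  using assms(3-6)
proof (induction i j rule: linorder_wlog)
  case (le i j)
  have "w ^ (j - i) - 1 = (w ^ l - 1) * (1 - w ^ (j - i)) - w ^ (l - i) * (w ^ i - w ^ j)"
    using le by (simp add: algebra_simps flip: power_add)
  then have "d dvd w ^ (j - i) - 1" using assms(2) le(5) by simp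
  moreover have "\<not> l dvd j - i" using le by (auto dest: dvd_imp_le)
  then have "coprime (j - i) l" using assms(1) by (metis coprime_commute prime_imp_coprime)
  ultimately show ?case
    using assms(2) le by (intro dvd_power_minus_one_coprime[of d w "j - i" l]) auto
next
  case (sym i j)
  then show ?case using dvd_minus_iff[of d "w ^ i - w ^ j"] by simp
qed

lemma minus_one_dvd_power_minus_one:
  fixes q k :: nat
  shows "q - 1 dvd q ^ k - 1"
proof (cases "q = 0")
  case False
  then show ?thesis
    using dvd_power_minus_one_mult[of "int q - 1" "int q" 1 k] by (simp flip: int_dvd_int_iff)
qed (cases k; simp)

lemma power_minus_one_dvd_power_minus_one_iff:
  fixes q a b :: nat
  assumes "q > 1"
  shows "q ^ a - 1 dvd q ^ b - 1 \<longleftrightarrow> a dvd b"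
proof
  assume "a dvd b"
  then show "q ^ a - 1 dvd q ^ b - 1"
    using minus_one_dvd_power_minus_one[of "q ^ a"] by (auto simp: power_mult)
next
  assume minus_one_dvd: "q ^ a - 1 dvd q ^ b - 1"
  show "a dvd b"
  proof (cases "a = 0")
    case True
    with minus_one_dvd assms show ?thesis by (cases "b = 0") (use one_less_power[of q b] in auto)
  next
    case False
    let ?r = "b mod a"
    have "[q ^ a = 1] (mod (q ^ a - 1))" using assms by (simp add: cong_altdef_nat)
    then have "[(q ^ a) ^ (b div a) * q ^ ?r = 1 ^ (b div a) * q ^ ?r] (mod (q ^ a - 1))"
      by (intro cong_mult cong_pow cong_refl)
    then have "[q ^ b = q ^ ?r] (mod (q ^ a - 1))" by (simp flip: power_mult power_add)
    moreover have "[q ^ b = 1] (mod (q ^ a - 1))"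
      using minus_one_dvd assms by (simp add: cong_altdef_nat)
    ultimately have "[q ^ ?r = 1] (mod (q ^ a - 1))" by (meson cong_sym cong_trans)
    then have "q ^ a - 1 dvd q ^ ?r - 1" using assms by (simp add: cong_altdef_nat)
    moreover have "q ^ ?r - 1 < q ^ a - 1"
      using False assms by (intro diff_less_mono power_strict_increasing) auto
    ultimately have "q ^ ?r \<le> 1" by (metis diff_is_0_eq dvd_imp_le leD neq0_conv)
    then have "?r = 0" using assms one_less_power[of q ?r] by (cases "?r = 0") auto
    then show ?thesis by auto
  qed
qed

lemma inj_on_power_root_of_unity:
  fixes z :: "'b::idom"
  assumes "prime l" "z ^ l = 1" "z \<noteq> 1"
  shows "inj_on (\<lambda>j. z ^ j) {..<l}"
proof (rule inj_onI)
  fix i j assume "i \<in> {..<l}" "j \<in> {..<l}" "z ^ i = z ^ j"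
  with assms show "i = j" using dvd_power_diff_imp_dvd_minus_one[of l 0 z i j] by auto
qed

lemma power_root_of_unity_eq_1_iff:
  fixes z :: "'b::idom"
  assumes "prime l" "z ^ l = 1" "z \<noteq> 1"
  shows "z ^ i = 1 \<longleftrightarrow> l dvd i"
proof -
  have "z ^ i = (z ^ l) ^ (i div l) * z ^ (i mod l)" by (simp flip: power_mult power_add)
  then have "z ^ i = 1 \<longleftrightarrow> z ^ (i mod l) = z ^ 0" using assms(2) by simp
  also have "\<dots> \<longleftrightarrow> i mod l = 0"
    using prime_gt_0_nat[OF assms(1)]
    by (intro inj_on_eq_iff[OF inj_on_power_root_of_unity[OF assms]]) auto
  finally show ?thesis by (simp add: dvd_eq_mod_eq_0)
qed

section \<open>Finite fields\<close>

lemma one_less_CARD: "CARD('a::{zero_neq_one,finite}) > 1"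
  using card_mono[of "UNIV :: 'a set" "{0, 1}"] by simp

lemma finite_field_power_CARD:
  fixes x :: "'a::{field,finite}"
  shows "x ^ CARD('a) = x"
proof (cases "x = 0")
  case False
  let ?U = "UNIV - {0 :: 'a}"
  have "\<Prod>?U = (\<Prod>y\<in>?U. x * y)"
    by (rule prod.reindex_bij_witness[of _ "\<lambda>y. x * y" "\<lambda>y. y / x"]) (use False in auto)
  also have "\<dots> = x ^ card ?U * \<Prod>?U" by (simp add: prod.distrib)
  finally have "x ^ card ?U = 1" by simp
  moreover have "CARD('a) = Suc (card ?U)" by (simp add: card_Diff_singleton one_less_CARD)
  ultimately show ?thesis by (simp only: power_Suc mult_1_right)
qed (simp add: card_gt_0_iff)

text \<open>As a polynomial function, \<open>(x + 1)\<^bsup>q\<^esup> - x\<^bsup>q\<^esup> - 1\<close> has degree less than \<open>q\<close> and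
  vanishes on all \<open>q\<close> elements of the field.\<close>
lemma finite_field_of_nat_binomial:
  fixes k :: nat
  assumes "0 < k" "k < CARD('a::{field,finite})"
  shows "of_nat (CARD('a) choose k) = (0 :: 'a)"
proof -
  let ?q = "CARD('a)"
  define f where "f = (\<Sum>j\<in>{0<..<?q}. monom (of_nat (?q choose j)) j :: 'a poly)"
  have "f = 0"
  proof (rule poly_eqI_degree[of UNIV])
    show "CARD('a) > degree f"
      unfolding f_def using assms
      by (intro degree_sum_less) (auto intro: le_less_trans[OF degree_monom_le])
    fix x :: 'a
    have "x + 1 = (x + 1) ^ ?q" by (simp add: finite_field_power_CARD)
    also have "\<dots> = (\<Sum>j\<le>?q. of_nat (?q choose j) * x ^ j)" by (simp add: binomial_ring)
    also have "{..?q} = insert 0 (insert ?q {0<..<?q})" using assms by auto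
    also have "(\<Sum>j\<in>\<dots>. of_nat (?q choose j) * x ^ j) = 1 + x + poly f x"
      using assms by (simp add: f_def poly_sum poly_monom finite_field_power_CARD)
    finally show "poly f x = poly 0 x" by simp
  qed (use assms in auto)
  moreover have "coeff f k = of_nat (?q choose k)" using assms by (simp add: f_def coeff_sum)
  ultimately show ?thesis by simp
qed

lemma finite_field_of_nat_neq_0:
  assumes "l dvd CARD('a::{field,finite}) - 1"
  shows "of_nat l \<noteq> (0 :: 'a)"
proof
  assume "of_nat l = (0 :: 'a)"
  obtain k where "CARD('a) - 1 = l * k" using assms by blast
  then have "CARD('a) = l * k + 1" using one_less_CARD[where 'a='a] by simp
  then have "of_nat CARD('a) = (1 :: 'a)" using \<open>of_nat l = 0\<close> by simp
  moreover have "of_nat CARD('a) = (0 :: 'a)"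
    using finite_field_of_nat_binomial[of 1, where 'a='a] one_less_CARD[where 'a='a] by simp
  ultimately show False by simp
qed

lemma add_power_CARD:
  fixes x y :: "'b::comm_ring_1"
  assumes "CHAR('b) = CHAR('a::{field,finite})"
  shows "(x + y) ^ (CARD('a) ^ k) = x ^ (CARD('a) ^ k) + y ^ (CARD('a) ^ k)"
proof (induction k arbitrary: x y)
  case (Suc k)
  let ?q = "CARD('a)"
  have "(x + y) ^ ?q = (\<Sum>j\<le>?q. of_nat (?q choose j) * x ^ j * y ^ (?q - j))"
    by (rule binomial_ring)
  also have "\<dots> = (\<Sum>j\<in>{0, ?q}. of_nat (?q choose j) * x ^ j * y ^ (?q - j))"
  proof (rule sum.mono_neutral_right)
    show "\<forall>j\<in>{..?q} - {0, ?q}. of_nat (?q choose j) * x ^ j * y ^ (?q - j) = 0"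
    proof
      fix j assume "j \<in> {..?q} - {0, ?q}"
      then have "CHAR('a) dvd ?q choose j"
        using finite_field_of_nat_binomial[of j, where 'a='a]
        by (simp add: of_nat_eq_0_iff_char_dvd)
      then have "of_nat (?q choose j) = (0 :: 'b)" by (simp add: of_nat_eq_0_iff_char_dvd assms)
      then show "of_nat (?q choose j) * x ^ j * y ^ (?q - j) = 0" by simp
    qed
  qed auto
  also have "\<dots> = x ^ ?q + y ^ ?q" using one_less_CARD[where 'a='a] by (simp add: add.commute)
  finally show ?case by (simp add: power_mult Suc.IH)
qed simp

lemma sum_power_CARD:
  fixes f :: "'c \<Rightarrow> 'b::comm_ring_1"
  assumes "CHAR('b) = CHAR('a::{field,finite})"
  shows "sum f I ^ (CARD('a) ^ k) = (\<Sum>i\<in>I. f i ^ (CARD('a) ^ k))"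
  by (induction I rule: infinite_finite_induct) (auto simp: add_power_CARD[OF assms] power_0_left)

section \<open>Quotient rings\<close>

lemma carrier_Quot: "carrier (R Quot I) = (\<lambda>x. I +>\<^bsub>R\<^esub> x) ` carrier R"
  by (auto simp: FactRing_def A_RCOSETS_def' a_r_coset_def')

lemma Quot_nat_pow:
  assumes "ideal I R" "x \<in> carrier R"
  shows "(I +>\<^bsub>R\<^esub> x) [^]\<^bsub>R Quot I\<^esub> (n::nat) = I +>\<^bsub>R\<^esub> (x [^]\<^bsub>R\<^esub> n)"
proof -
  interpret ring_hom_ring R "R Quot I" "(+>\<^bsub>R\<^esub>) I" using assms(1) by (rule ideal.rcos_ring_hom_ring)
  show ?thesis using hom_nat_pow[OF assms(2)] by simp
qed

lemma Quot_eq_iff: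
  assumes "ideal I R" "x \<in> carrier R" "y \<in> carrier R"
  shows "I +>\<^bsub>R\<^esub> x = I +>\<^bsub>R\<^esub> y \<longleftrightarrow> x \<ominus>\<^bsub>R\<^esub> y \<in> I"
  using ring.quotient_eq_iff_same_a_r_cos[OF ideal.axioms(2)[OF assms(1)] assms] by simp

lemma Quot_eq_zero_iff:
  assumes "ideal I R" "x \<in> carrier R"
  shows "I +>\<^bsub>R\<^esub> x = \<zero>\<^bsub>R Quot I\<^esub> \<longleftrightarrow> x \<in> I"
proof -
  interpret ideal I R by fact
  show ?thesis using assms(2) a_coset_join1[OF _ _ a_subgroup] a_coset_join2[OF _ a_subgroup]
    by (auto simp: FactRing_def)
qed

lemma bij_betw_representatives_Quot:
  assumes ideal: "ideal I R" and subset: "T \<subseteq> carrier R"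
    and representative: "\<And>x. x \<in> carrier R \<Longrightarrow> \<exists>t\<in>T. x \<ominus>\<^bsub>R\<^esub> t \<in> I"
    and unique: "\<And>s t. s \<in> T \<Longrightarrow> t \<in> T \<Longrightarrow> s \<ominus>\<^bsub>R\<^esub> t \<in> I \<Longrightarrow> s = t"
  shows "bij_betw (\<lambda>x. I +>\<^bsub>R\<^esub> x) T (carrier (R Quot I))"
proof (rule bij_betw_imageI)
  show "inj_on (\<lambda>x. I +>\<^bsub>R\<^esub> x) T"
    using subset unique by (auto simp: inj_on_def subset_iff Quot_eq_iff[OF ideal])
  show "(\<lambda>x. I +>\<^bsub>R\<^esub> x) ` T = carrier (R Quot I)"
  proof
    show "(\<lambda>x. I +>\<^bsub>R\<^esub> x) ` T \<subseteq> carrier (R Quot I)" using subset by (auto simp: carrier_Quot)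
    show "carrier (R Quot I) \<subseteq> (\<lambda>x. I +>\<^bsub>R\<^esub> x) ` T"
    proof
      fix X assume "X \<in> carrier (R Quot I)"
      then obtain x where x_coset: "x \<in> carrier R" "X = I +>\<^bsub>R\<^esub> x" by (auto simp: carrier_Quot)
      then obtain t where t_rep: "t \<in> T" "x \<ominus>\<^bsub>R\<^esub> t \<in> I" using representative by blast
      with x_coset subset have "X = I +>\<^bsub>R\<^esub> t" using Quot_eq_iff[OF ideal] by blast
      with t_rep(1) show "X \<in> (\<lambda>x. I +>\<^bsub>R\<^esub> x) ` T" by blast
    qed
  qed
qed

lemma (in domain) field_if_finite:
  assumes "finite (carrier R)"
  shows "field R"
proof (rule cring_fieldI2)
  fix a assume a_nonzero: "a \<in> carrier R" "a \<noteq> \<zero>"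
  then have "inj_on (\<lambda>x. a \<otimes> x) (carrier R)" by (auto simp: inj_on_def m_lcancel)
  then have "(\<lambda>x. a \<otimes> x) ` carrier R = carrier R"
    using a_nonzero assms by (intro endo_inj_surj) auto
  then show "\<exists>b\<in>carrier R. a \<otimes> b = \<one>" by (metis imageE one_closed)
qed (use one_not_zero in auto)

lemma (in field) finite_field_generatorE:
  assumes finite_carrier: "finite (carrier R)"
  obtains a where "a \<in> carrier R" "a \<noteq> \<zero>" "\<And>n::nat. a [^] n = \<one> \<longleftrightarrow> card (carrier R) - 1 dvd n"
proof -
  interpret units: group "mult_of R" rewrites
      "([^]\<^bsub>mult_of R\<^esub>) = (([^]) :: _ \<Rightarrow> nat \<Rightarrow> _)" and "\<one>\<^bsub>mult_of R\<^esub> = \<one>"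
    by (rule field_mult_group) (simp_all add: fun_eq_iff nat_pow_def)
  have finite_mult: "finite (carrier (mult_of R))" using finite_carrier by (rule finite_mult_of)
  obtain a where generator: "a \<in> carrier (mult_of R)"
      "carrier (mult_of R) = {a [^] i | i::nat. i \<in> UNIV}"
    using finite_field_mult_group_has_gen[OF finite_carrier] by blast
  have "group.ord (mult_of R) a = card (carrier (mult_of R))"
  proof (rule antisym)
    have "carrier (mult_of R) = (\<lambda>i. a [^] i) ` {0..group.ord (mult_of R) a - 1}"
      using units.ord_elems[OF finite_mult generator(1)] generator(2) by auto
    also have "card \<dots> \<le> card {0..group.ord (mult_of R) a - 1}" by (rule card_image_le) simp
    finally show "card (carrier (mult_of R)) \<le> group.ord (mult_of R) a"
      using units.ord_ge_1[OF finite_mult generator(1)] by simp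
    show "group.ord (mult_of R) a \<le> card (carrier (mult_of R))"
      using units.ord_le_group_order[OF finite_mult generator(1)] by (simp add: Coset.order_def)
  qed
  then have "group.ord (mult_of R) a = card (carrier R) - 1"
    using order_mult_of[OF finite_carrier] by (simp add: Coset.order_def)
  with generator(1) that[of a] show thesis by (auto simp: units.pow_eq_id)
qed

lemma (in field) finite_field_pow_card_minus_one:
  assumes "finite (carrier R)" "a \<in> carrier R" "a \<noteq> \<zero>"
  shows "a [^] (card (carrier R) - 1) = \<one>"
proof -
  interpret units: group "mult_of R" rewrites
      "([^]\<^bsub>mult_of R\<^esub>) = (([^]) :: _ \<Rightarrow> nat \<Rightarrow> _)" and "\<one>\<^bsub>mult_of R\<^esub> = \<one>"
    by (rule field_mult_group) (simp_all add: fun_eq_iff nat_pow_def)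
  have "a [^] Coset.order (mult_of R) = \<one>" using assms(2,3) by (intro units.pow_order_eq_1) auto
  then show ?thesis using order_mult_of[OF assms(1)] by (simp add: Coset.order_def)
qed

lemma card_residue_field_dvd_if_carmichael:
  fixes R (structure)
  assumes carmichael: "ideal I R" "carmichael_ring (R Quot I)" "I \<subseteq> J"
    and residue_field: "ideal J R" "field (R Quot J)" "finite (carrier (R Quot J))"
  shows "card (carrier (R Quot J)) - 1 dvd card (carrier (R Quot I)) - 1"
proof -
  let ?N = "card (carrier (R Quot I))"
  interpret ring R using carmichael(1) by (rule ideal.axioms(2))
  interpret Quot_J: field "R Quot J" by fact
  obtain X where generator: "X \<in> carrier (R Quot J)" "X \<noteq> \<zero>\<^bsub>R Quot J\<^esub>"
      "\<And>n::nat. X [^]\<^bsub>R Quot J\<^esub> n = \<one>\<^bsub>R Quot J\<^esub> \<longleftrightarrow> card (carrier (R Quot J)) - 1 dvd n"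
    using Quot_J.finite_field_generatorE[OF residue_field(3)] by blast
  obtain x where x_coset: "x \<in> carrier R" "X = J +>\<^bsub>R\<^esub> x"
    using generator(1) by (auto simp: carrier_Quot)
  have "finite (carrier (R Quot I))" "carrier (R Quot I) \<noteq> {}"
    using carmichael(2) x_coset(1) by (auto simp: carmichael_ring_def carrier_Quot)
  then obtain n where card_eq: "?N = Suc n" by (cases ?N) auto
  have "I +> x \<in> carrier (R Quot I)" using x_coset(1) by (simp add: carrier_Quot)
  then have "(I +> x) [^]\<^bsub>R Quot I\<^esub> ?N = I +> x"
    using carmichael(2) unfolding carmichael_ring_def by blast
  then have "x [^] ?N \<ominus> x \<in> I"
    using x_coset(1) by (simp add: Quot_nat_pow[OF carmichael(1)] Quot_eq_iff[OF carmichael(1)])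
  then have "J +> (x [^] ?N) = J +> x"
    using carmichael(3) x_coset(1) Quot_eq_iff[OF residue_field(1), of "x [^] ?N" x] by auto
  then have "X [^]\<^bsub>R Quot J\<^esub> ?N = X" using x_coset by (simp add: Quot_nat_pow[OF residue_field(1)])
  then have "X \<otimes>\<^bsub>R Quot J\<^esub> X [^]\<^bsub>R Quot J\<^esub> n = X \<otimes>\<^bsub>R Quot J\<^esub> \<one>\<^bsub>R Quot J\<^esub>"
    using generator(1) by (simp add: card_eq Quot_J.m_comm)
  then have "X [^]\<^bsub>R Quot J\<^esub> n = \<one>\<^bsub>R Quot J\<^esub>"
    using Quot_J.m_lcancel[OF generator(2,1) Quot_J.nat_pow_closed[OF generator(1)] Quot_J.one_closed]
    by simp
  then show ?thesis using generator(3) card_eq by simp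
qed

section \<open>Residue rings of $\mathbb{F}_q[t]$\<close>

lemma poly_ring_simps [simp]:
  "carrier poly_ring = UNIV" "x \<otimes>\<^bsub>poly_ring\<^esub> y = x * y" "x \<oplus>\<^bsub>poly_ring\<^esub> y = x + y"
  "\<one>\<^bsub>poly_ring\<^esub> = 1" "\<zero>\<^bsub>poly_ring\<^esub> = 0"
  by (simp_all add: poly_ring_def)

lemma cring_poly_ring: "cring (poly_ring :: 'a::field poly ring)"
proof (rule cringI)
  show "abelian_group (poly_ring :: 'a poly ring)"
  proof (rule abelian_groupI)
    fix x :: "'a poly"
    show "\<exists>y\<in>carrier poly_ring. y \<oplus>\<^bsub>poly_ring\<^esub> x = \<zero>\<^bsub>poly_ring\<^esub>"
      by (rule bexI[of _ "- x"]) auto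
  qed (auto simp: algebra_simps)
  show "Group.comm_monoid (poly_ring :: 'a poly ring)"
    by (rule comm_monoidI) (auto simp: algebra_simps)
qed (auto simp: algebra_simps)

lemma poly_ring_minus [simp]: "x \<ominus>\<^bsub>poly_ring\<^esub> y = x - y"
proof -
  interpret cring poly_ring by (rule cring_poly_ring)
  have "\<ominus>\<^bsub>poly_ring\<^esub> y = - y" by (rule minus_equality) auto
  then show ?thesis by (simp add: a_minus_def)
qed

lemma poly_ring_pow [simp]: "x [^]\<^bsub>poly_ring\<^esub> (n::nat) = x ^ n"
  by (induction n) (simp_all add: nat_pow_def poly_ring_def mult.commute)

lemma mem_PIdl_poly_ring: "x \<in> PIdl\<^bsub>poly_ring\<^esub> g \<longleftrightarrow> g dvd x"
  by (auto simp: cgenideal_def dvd_def mult.commute)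

lemma ideal_PIdl_poly_ring: "ideal (PIdl\<^bsub>poly_ring\<^esub> g) poly_ring"
  by (rule cring.cgenideal_ideal[OF cring_poly_ring]) simp

lemma irreducible_iff_primeideal_poly_ring:
  fixes p :: "'a::field poly"
  assumes "p \<noteq> 0"
  shows "irreducible p \<longleftrightarrow> primeideal (PIdl\<^bsub>poly_ring\<^esub> p) poly_ring"
proof
  assume irreducible: "irreducible p"
  then have "1 \<notin> PIdl\<^bsub>poly_ring\<^esub> p" by (simp add: mem_PIdl_poly_ring irreducible_not_unit)
  then have "carrier poly_ring \<noteq> PIdl\<^bsub>poly_ring\<^esub> p" by auto
  then show "primeideal (PIdl\<^bsub>poly_ring\<^esub> p) poly_ring"
    using field_poly_irreducible_imp_prime[OF irreducible]
    by (intro primeidealI ideal_PIdl_poly_ring cring_poly_ring)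
      (auto simp: mem_PIdl_poly_ring prime_elem_dvd_mult_iff)
next
  assume "primeideal (PIdl\<^bsub>poly_ring\<^esub> p) poly_ring"
  then interpret primeideal "PIdl\<^bsub>poly_ring\<^esub> p" poly_ring .
  have "\<not> p dvd 1" using I_notcarr mem_PIdl_poly_ring[of _ p] by (auto intro: dvd_trans)
  moreover have "p dvd a * b \<Longrightarrow> p dvd a \<or> p dvd b" for a b
    using I_prime[of a b] by (simp add: mem_PIdl_poly_ring)
  ultimately have "prime_elem p" using assms by (intro prime_elemI)
  then show "irreducible p" by (rule prime_elem_imp_irreducible)
qed

lemma
  fixes C :: "'b::zero set"
  assumes coeffs: "finite C" "0 \<in> C"
  shows finite_polys_degree_le: "finite {f. degree f \<le> n \<and> (\<forall>i. coeff f i \<in> C)}" (is "finite (?S n)")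
    and card_polys_degree_le: "card {f. degree f \<le> n \<and> (\<forall>i. coeff f i \<in> C)} = card C ^ Suc n"
proof -
  have "finite (?S n) \<and> card (?S n) = card C ^ Suc n"
  proof (induction n)
    case 0
    have "?S 0 = (\<lambda>c. [:c:]) ` C"
      using coeffs(2) by (auto simp: coeff_pCons image_iff split: nat.splits elim!: degree_eq_zeroE)
    moreover have "inj_on (\<lambda>c. [:c:]) C" by (auto simp: inj_on_def)
    ultimately show ?case using coeffs(1) by (simp add: card_image)
  next
    case (Suc n)
    have "?S (Suc n) = (\<lambda>(c, f). pCons c f) ` (C \<times> ?S n)"
    proof (intro equalityI subsetI)
      fix f assume f_bounded: "f \<in> ?S (Suc n)"
      obtain c f' where f_eq: "f = pCons c f'" by (cases f)
      have "coeff f 0 \<in> C" "\<And>i. coeff f (Suc i) \<in> C" "degree f \<le> Suc n" using f_bounded by blast+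
      then have "c \<in> C" "f' \<in> ?S n" by (auto simp: f_eq split: if_splits)
      with f_eq show "f \<in> (\<lambda>(c, f). pCons c f) ` (C \<times> ?S n)" by auto
    next
      fix f assume "f \<in> (\<lambda>(c, f). pCons c f) ` (C \<times> ?S n)"
      then show "f \<in> ?S (Suc n)" by (auto simp: coeff_pCons split: nat.splits)
    qed
    moreover have "inj_on (\<lambda>(c, f). pCons c f) (C \<times> ?S n)" by (auto simp: inj_on_def)
    ultimately show ?case using Suc coeffs(1) by (simp add: card_image card_cartesian_product)
  qed
  then show "finite (?S n)" "card (?S n) = card C ^ Suc n" by auto
qed

lemma
  assumes "n > 0"
  shows finite_polys_degree_less: "finite {f :: 'b::{zero,finite} poly. degree f < n}"
    and card_polys_degree_less: "card {f :: 'b poly. degree f < n} = CARD('b) ^ n"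
proof -
  obtain k where n_eq: "n = Suc k" using assms by (cases n) auto
  show "finite {f :: 'b poly. degree f < n}" "card {f :: 'b poly. degree f < n} = CARD('b) ^ n"
    using finite_polys_degree_le[of "UNIV :: 'b set" k] card_polys_degree_le[of "UNIV :: 'b set" k]
    by (simp_all add: n_eq less_Suc_eq_le)
qed

lemma
  fixes g :: "'a::{field,finite} poly"
  assumes "degree g > 0"
  shows finite_poly_ring_Quot: "finite (carrier (poly_ring Quot PIdl\<^bsub>poly_ring\<^esub> g))"
    and card_poly_ring_Quot: "card (carrier (poly_ring Quot PIdl\<^bsub>poly_ring\<^esub> g)) = CARD('a) ^ degree g"
proof -
  let ?I = "PIdl\<^bsub>poly_ring\<^esub> g" and ?T = "{f. degree f < degree g}"
  have bij_representatives: "bij_betw (\<lambda>x. ?I +>\<^bsub>poly_ring\<^esub> x) ?T (carrier (poly_ring Quot ?I))"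
  proof (rule bij_betw_representatives_Quot[OF ideal_PIdl_poly_ring])
    fix x
    have "x mod g \<in> ?T" using assms degree_mod_less[of g x] by (cases "g = 0") auto
    then show "\<exists>t\<in>?T. x \<ominus>\<^bsub>poly_ring\<^esub> t \<in> ?I"
      by (intro bexI[of _ "x mod g"]) (auto simp: mem_PIdl_poly_ring)
  next
    fix s t assume congruent: "s \<in> ?T" "t \<in> ?T" "s \<ominus>\<^bsub>poly_ring\<^esub> t \<in> ?I"
    then have "degree (s - t) < degree g" by (auto intro: degree_diff_less)
    with congruent(3) show "s = t"
      using dvd_imp_degree_le[of g "s - t"] by (auto simp: mem_PIdl_poly_ring)
  qed auto
  show "finite (carrier (poly_ring Quot ?I))" "card (carrier (poly_ring Quot ?I)) = CARD('a) ^ degree g"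
    using bij_betw_finite[OF bij_representatives] bij_betw_same_card[OF bij_representatives]
      finite_polys_degree_less[OF assms, where 'b='a] card_polys_degree_less[OF assms, where 'b='a]
        by auto
qed

lemma field_poly_ring_Quot:
  fixes p :: "'a::{field,finite} poly"
  assumes "irreducible p"
  shows "field (poly_ring Quot PIdl\<^bsub>poly_ring\<^esub> p)"
proof -
  have "p \<noteq> 0" using assms by auto
  with assms have "primeideal (PIdl\<^bsub>poly_ring\<^esub> p) poly_ring"
    by (simp add: irreducible_iff_primeideal_poly_ring)
  then show ?thesis
    using finite_poly_ring_Quot[OF irreducible_field_poly_degree_pos[OF assms]]
    by (intro domain.field_if_finite primeideal.quotient_is_domain)
qed

lemma irreducible_if_field_poly_ring_Quot:
  fixes g :: "'a::field poly"
  assumes "g \<noteq> 0" "field (poly_ring Quot PIdl\<^bsub>poly_ring\<^esub> g)"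
  shows "irreducible g"
  using cring.quot_domain_imp_primeideal[OF cring_poly_ring ideal_PIdl_poly_ring
      field.axioms(1)[OF assms(2)]]
    irreducible_iff_primeideal_poly_ring[OF assms(1)] by simp

lemma poly_fermat:
  fixes p c :: "'a::{field,finite} poly"
  assumes "irreducible p" "\<not> p dvd c"
  shows "p dvd c ^ (CARD('a) ^ degree p - 1) - 1"
proof -
  let ?I = "PIdl\<^bsub>poly_ring\<^esub> p" and ?n = "CARD('a) ^ degree p - 1"
  note ideal = ideal_PIdl_poly_ring[of p]
  interpret field "poly_ring Quot ?I" using assms(1) by (rule field_poly_ring_Quot)
  note degree_pos = irreducible_field_poly_degree_pos[OF assms(1)]
  have "?I +>\<^bsub>poly_ring\<^esub> c \<in> carrier (poly_ring Quot ?I)" "?I +>\<^bsub>poly_ring\<^esub> c \<noteq> \<zero>\<^bsub>poly_ring Quot ?I\<^esub>"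
    using assms(2) by (simp_all add: carrier_Quot Quot_eq_zero_iff[OF ideal] mem_PIdl_poly_ring)
  then have "(?I +>\<^bsub>poly_ring\<^esub> c) [^]\<^bsub>poly_ring Quot ?I\<^esub> ?n = \<one>\<^bsub>poly_ring Quot ?I\<^esub>"
    using finite_field_pow_card_minus_one[OF finite_poly_ring_Quot[OF degree_pos]]
    by (simp add: card_poly_ring_Quot[OF degree_pos])
  then have "?I +>\<^bsub>poly_ring\<^esub> (c ^ ?n) = ?I +>\<^bsub>poly_ring\<^esub> 1"
    by (simp add: Quot_nat_pow[OF ideal]) (simp add: FactRing_def)
  then show ?thesis by (simp add: Quot_eq_iff[OF ideal] mem_PIdl_poly_ring)
qed

lemma poly_fermat_power:
  fixes p c :: "'a::{field,finite} poly"
  assumes "irreducible p" "degree p dvd n"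
  shows "p dvd c ^ (CARD('a) ^ n) - c"
proof (cases "p dvd c")
  case True
  then have "p dvd c ^ (CARD('a) ^ n)"
    by (metis dvd_power dvd_trans one_less_CARD gr_implies_not0 zero_less_power neq0_conv)
  with True show ?thesis by simp
next
  case False
  have "CARD('a) ^ degree p - 1 dvd CARD('a) ^ n - 1"
    using assms(2) power_minus_one_dvd_power_minus_one_iff[OF one_less_CARD] by blast
  then have "p dvd c ^ (CARD('a) ^ n - 1) - 1"
    using dvd_power_minus_one_mult[OF poly_fermat[OF assms(1) False]] by auto
  moreover have "c ^ (CARD('a) ^ n) - c = c * (c ^ (CARD('a) ^ n - 1) - 1)"
    by (simp add: right_diff_distrib power_eq_if[of c "CARD('a) ^ n"])
  ultimately show ?thesis by simp
qed

lemma korselt_carmichael_poly: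
  fixes g :: "'a::{field,finite} poly"
  assumes "degree g > 0" "squarefree g" "\<not> irreducible g"
    and degree_dvd: "\<And>p. irreducible p \<Longrightarrow> p dvd g \<Longrightarrow> degree p dvd degree g"
  shows "carmichael_poly g"
  unfolding carmichael_poly_def carmichael_ideal_def carmichael_ring_def
proof (intro conjI ballI)
  let ?Q = "poly_ring Quot PIdl\<^bsub>poly_ring\<^esub> g"
  show "finite (carrier ?Q)" using assms(1) by (rule finite_poly_ring_Quot)
  have "g \<noteq> 0" using assms(1) by auto
  with assms(3) show "\<not> field ?Q" using irreducible_if_field_poly_ring_Quot by blast
  fix a assume "a \<in> carrier ?Q"
  then obtain x where a_eq: "a = PIdl\<^bsub>poly_ring\<^esub> g +>\<^bsub>poly_ring\<^esub> x" by (auto simp: carrier_Quot)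
  have "g dvd x ^ (CARD('a) ^ degree g) - x"
    using assms(2) by (rule squarefree_field_poly_dvdI) (intro poly_fermat_power degree_dvd)
  then show "a [^]\<^bsub>?Q\<^esub> card (carrier ?Q) = a"
    by (simp add: a_eq card_poly_ring_Quot[OF assms(1)] Quot_nat_pow[OF ideal_PIdl_poly_ring]
        Quot_eq_iff[OF ideal_PIdl_poly_ring] mem_PIdl_poly_ring)
qed

section \<open>Power residues\<close>

lemma power_nonresidueE:
  fixes p :: "'a::{field,finite} poly"
  assumes "irreducible p" "prime l" "l dvd CARD('a) ^ degree p - 1"
  obtains n where "\<not> p dvd n" "\<not> p dvd n ^ ((CARD('a) ^ degree p - 1) div l) - 1"
proof -
  let ?I = "PIdl\<^bsub>poly_ring\<^esub> p" and ?n = "CARD('a) ^ degree p - 1"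
  note ideal = ideal_PIdl_poly_ring[of p]
  note degree_pos = irreducible_field_poly_degree_pos[OF assms(1)]
  interpret field "poly_ring Quot ?I" using assms(1) by (rule field_poly_ring_Quot)
  obtain a where generator: "a \<in> carrier (poly_ring Quot ?I)" "a \<noteq> \<zero>\<^bsub>poly_ring Quot ?I\<^esub>"
      "\<And>n::nat. a [^]\<^bsub>poly_ring Quot ?I\<^esub> n = \<one>\<^bsub>poly_ring Quot ?I\<^esub> \<longleftrightarrow> ?n dvd n"
    using finite_field_generatorE[OF finite_poly_ring_Quot[OF degree_pos]]
    by (auto simp: card_poly_ring_Quot[OF degree_pos])
  obtain n where a_eq: "a = ?I +>\<^bsub>poly_ring\<^esub> n" using generator(1) by (auto simp: carrier_Quot)
  have "?n > 0" using one_less_power[OF one_less_CARD[where 'a='a] degree_pos] by simp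
  then have "0 < ?n div l" "?n div l < ?n"
    using assms(3) prime_gt_1_nat[OF assms(2)] by (auto simp: div_greater_zero_iff dvd_imp_le)
  then have "\<not> ?n dvd ?n div l" by (auto dest: dvd_imp_le)
  then have "?I +>\<^bsub>poly_ring\<^esub> (n ^ (?n div l)) \<noteq> ?I +>\<^bsub>poly_ring\<^esub> 1"
    using generator(3)[of "?n div l"]
    by (simp add: a_eq Quot_nat_pow[OF ideal]) (simp add: FactRing_def)
  then have "\<not> p dvd n ^ (?n div l) - 1" by (simp add: Quot_eq_iff[OF ideal] mem_PIdl_poly_ring)
  moreover have "\<not> p dvd n"
    using generator(2) by (simp add: a_eq Quot_eq_zero_iff[OF ideal] mem_PIdl_poly_ring)
  ultimately show thesis using that by blast
qed

lemma finite_field_root_of_unityE: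
  assumes "prime l" "l dvd CARD('a::{field,finite}) - 1"
  obtains z :: "'a::{field,finite}" where "z ^ l = 1" "z \<noteq> 1"
proof -
  let ?e = "(CARD('a) - 1) div l"
  have X_dvd_iff: "[:0, 1:] dvd f \<longleftrightarrow> poly f 0 = 0" for f :: "'a poly"
    using poly_eq_0_iff_dvd[of f 0] by simp
  have irreducible_X: "irreducible [:0, 1 :: 'a:]" by (rule irreducible_linear_field_poly) simp
  then obtain n :: "'a poly" where nonresidue: "\<not> [:0, 1:] dvd n" "\<not> [:0, 1:] dvd n ^ ?e - 1"
    using power_nonresidueE[OF irreducible_X assms(1)] assms(2) by auto
  have "(poly n 0 ^ ?e) ^ l = poly n 0 ^ (CARD('a) - 1)" using assms(2) by (simp flip: power_mult)
  also have "\<dots> = 1" using poly_fermat[OF irreducible_X nonresidue(1)] by (simp add: X_dvd_iff)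
  finally show thesis using that[of "poly n 0 ^ ?e"] nonresidue(2) by (simp add: X_dvd_iff)
qed

lemma large_irreducible_factorsE:
  fixes p :: "'a::{field,finite} poly"
  assumes "irreducible p"
  obtains N where "N \<noteq> 0" "\<not> p dvd N"
    "\<And>n r. N dvd n - 1 \<Longrightarrow> \<not> p dvd n \<Longrightarrow> irreducible r \<Longrightarrow> r dvd n \<Longrightarrow> degree r > d"
proof
  let ?S = "{f :: 'a poly. degree f < Suc d \<and> \<not> p dvd f}"
  have finite_S: "finite ?S" using finite_polys_degree_less[of "Suc d", where 'b='a] by simp
  show "\<not> p dvd \<Prod>?S"
  proof
    assume "p dvd \<Prod>?S"
    with field_poly_irreducible_imp_prime[OF assms] obtain f where "f \<in> ?S" "p dvd f"
      by (rule prime_elem_dvd_prodE)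
    then show False by simp
  qed
  then show "\<Prod>?S \<noteq> 0" by auto
  fix n r assume n_cong: "\<Prod>?S dvd n - 1" "\<not> p dvd n" and factor: "irreducible r" "r dvd n"
  have "\<not> r dvd \<Prod>?S"
  proof
    assume "r dvd \<Prod>?S"
    with n_cong(1) factor(2) have "r dvd n - (n - 1)" by (meson dvd_diff dvd_trans)
    with factor(1) show False by (simp add: irreducible_not_unit)
  qed
  then have "r \<notin> ?S" using dvd_prodI[OF finite_S, of r "\<lambda>f. f"] by auto
  moreover have "\<not> p dvd r" using n_cong(2) factor(2) by (meson dvd_trans)
  ultimately show "degree r > d" by auto
qed

lemma large_irreducible_polyE:
  fixes p :: "'a::{field,finite} poly"
  assumes "irreducible p"
  obtains r where "irreducible r" "degree r > d" "\<not> p dvd r"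
proof -
  obtain N where large_factors: "N \<noteq> 0"
      "\<And>n r. N dvd n - 1 \<Longrightarrow> \<not> p dvd n \<Longrightarrow> irreducible r \<Longrightarrow> r dvd n \<Longrightarrow> degree r > d"
    using assms by (rule large_irreducible_factorsE) blast
  define n where "n = [:0, 1:] * (p * N) + 1"
  have "degree ([:0, 1:] * (p * N)) > 0" using large_factors(1) assms by (subst degree_mult_eq) auto
  then have "degree n > 0" unfolding n_def by (subst degree_add_eq_left) simp_all
  then obtain r where factor: "irreducible r" "r dvd n" by (rule field_poly_irreducible_divisorE)
  have "\<not> p dvd n"
    using assms unfolding n_def
    by (simp add: dvd_add_right_iff irreducible_not_unit del: mult_pCons_left)
  moreover from this factor(2) have "\<not> p dvd r" by (meson dvd_trans)
  moreover have "N dvd n - 1" by (simp add: n_def del: mult_pCons_left)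
  ultimately show thesis using that[OF factor(1)] large_factors(2) factor by blast
qed

lemma congruent_poly_with_large_factorsE:
  fixes p a :: "'a::{field,finite} poly"
  assumes irreducible_p: "irreducible p" and not_dvd_a: "\<not> p dvd a"
  obtains n where "p dvd n - a" "\<And>r. irreducible r \<Longrightarrow> r dvd n \<Longrightarrow> degree r > d \<and> \<not> p dvd r"
proof -
  let ?k = "CARD('a) ^ degree p - 1"
  obtain N where large_factors: "\<not> p dvd N"
      "\<And>n r. N dvd n - 1 \<Longrightarrow> \<not> p dvd n \<Longrightarrow> irreducible r \<Longrightarrow> r dvd n \<Longrightarrow> degree r > d"
    using irreducible_p by (rule large_irreducible_factorsE) blast
  define n where "n = 1 + N ^ ?k * (a - 1)"
  have "n - a = (N ^ ?k - 1) * (a - 1)" by (simp add: n_def algebra_simps)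
  then have n_cong_a: "p dvd n - a" using poly_fermat[OF irreducible_p large_factors(1)] by simp
  have not_dvd_n: "\<not> p dvd n"
  proof
    assume "p dvd n"
    then have "p dvd n - (n - a)" using n_cong_a by (rule dvd_diff)
    with not_dvd_a show False by simp
  qed
  have "N dvd n - 1"
    using one_less_power[OF one_less_CARD[where 'a='a]
        irreducible_field_poly_degree_pos[OF irreducible_p]]
    by (simp add: n_def)
  with large_factors(2) not_dvd_n have "degree r > d \<and> \<not> p dvd r" if "irreducible r" "r dvd n" for r
    using that by (blast intro: dvd_trans)
  with n_cong_a show thesis by (rule that)
qed

text \<open>If all large irreducible polynomials were \<open>e\<close>-th power residues modulo \<open>p\<close>, then so would
  be the constants, as quotients of associated irreducibles, and hence all polynomials prime to \<open>p\<close>.\<close>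
lemma large_irreducible_power_nonresidueE:
  fixes p a :: "'a::{field,finite} poly"
  assumes irreducible_p: "irreducible p" and nonresidue_a: "\<not> p dvd a" "\<not> p dvd a ^ e - 1"
  obtains m where "irreducible m" "degree m > d" "\<not> p dvd m" "\<not> p dvd m ^ e - 1"
proof (rule ccontr)
  assume "\<not> thesis"
  with that have residue: "p dvd r ^ e - 1" if "irreducible r" "degree r > d" "\<not> p dvd r" for r
    using that by blast
  have const_residue: "p dvd [:c:] ^ e - 1" if "c \<noteq> 0" for c
  proof -
    obtain r where large_r: "irreducible r" "degree r > d" "\<not> p dvd r"
      using irreducible_p by (rule large_irreducible_polyE)
    have "irreducible ([:c:] * r)"
      using that large_r(1) by (subst irreducible_mult_unit_left) (simp_all add: is_unit_pCons_iff)
    then have "p dvd ([:c:] * r) ^ e - 1"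
      using that large_r(2,3) by (intro residue) (auto simp: dvd_smult_iff)
    then show ?thesis by (simp only: dvd_mult_power_minus_one_iff[OF residue[OF large_r]])
  qed
  obtain n where large_factors: "p dvd n - a" "\<And>r. irreducible r \<Longrightarrow> r dvd n \<Longrightarrow> degree r > d \<and> \<not> p dvd r"
    using irreducible_p nonresidue_a(1) by (rule congruent_poly_with_large_factorsE) blast
  have "n \<noteq> 0" using large_factors(1) nonresidue_a(1) by auto
  then obtain c F where factorization: "c \<noteq> 0" "n = smult c (prod_mset F)" "\<And>r. r \<in># F \<Longrightarrow> irreducible r"
    by (rule field_poly_factorizationE) blast
  have "\<forall>r. r \<in># F \<longrightarrow> p dvd r ^ e - 1"
    using factorization(2,3) large_factors(2) residue by (simp add: dvd_prod_mset dvd_smult)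
  then have "p dvd prod_mset F ^ e - 1" by (induction F) (auto simp: dvd_mult_power_minus_one_iff)
  then have "p dvd ([:c:] * prod_mset F) ^ e - 1"
    using const_residue[OF factorization(1)] by (simp only: dvd_mult_power_minus_one_iff)
  then have "p dvd n ^ e - 1" by (simp add: factorization(2))
  moreover have "n - a dvd n ^ e - a ^ e" by (simp add: power_diff_sumr2)
  with large_factors(1) have "p dvd n ^ e - a ^ e" by (rule dvd_trans)
  ultimately have "p dvd (n ^ e - 1) - (n ^ e - a ^ e)" by (rule dvd_diff)
  with nonresidue_a(2) show False by simp
qed

section \<open>Kummer polynomials\<close>

definition kummer_poly :: "nat \<Rightarrow> 'b::comm_ring_1 \<Rightarrow> 'b poly" where
  "kummer_poly n c = monom 1 n - [:c:]"

lemma coeff_kummer_poly: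
  "n > 0 \<Longrightarrow> coeff (kummer_poly n c) i = (if i = n then 1 else if i = 0 then - c else 0)"
  by (auto simp: kummer_poly_def coeff_pCons split: nat.splits)

lemma degree_kummer_poly [simp]: "n > 0 \<Longrightarrow> degree (kummer_poly n c) = n"
  by (intro antisym degree_le le_degree) (auto simp: coeff_kummer_poly)

lemma fract_poly_kummer_poly [simp]:
  "n > 0 \<Longrightarrow> fract_poly (kummer_poly n c) = kummer_poly n (to_fract c)"
  by (intro poly_eqI) (simp add: coeff_kummer_poly)

lemma kummer_poly_eq_iff: "kummer_poly n c = kummer_poly n d \<longleftrightarrow> c = d"
  by (simp add: kummer_poly_def)

definition twist :: "'b::comm_ring_1 \<Rightarrow> 'b poly \<Rightarrow> 'b poly" where
  "twist z s = pcompose s [:0, z:]"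

lemma coeff_twist: "coeff (twist z s) i = z ^ i * coeff s i"
  by (simp add: twist_def coeff_pcompose_linear)

lemma twist_twist: "twist y (twist z s) = twist (y * z) s"
  by (rule poly_eqI) (simp add: coeff_twist power_mult_distrib)

lemma twist_1 [simp]: "twist 1 s = s"
  by (simp add: twist_def)

lemma twist_const [simp]: "twist z [:c:] = [:c:]"
  by (simp add: twist_def)

lemma twist_zero [simp]: "twist z 0 = 0"
  by (simp add: twist_def)

lemma twist_one [simp]: "twist z 1 = 1"
  by (simp add: twist_def pcompose_1)

lemma twist_add: "twist z (s + t) = twist z s + twist z t"
  and twist_uminus: "twist z (- s) = - twist z s"
  and twist_mult: "twist z (s * t) = twist z s * twist z t"
  by (simp_all add: twist_def pcompose_add pcompose_uminus pcompose_mult)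

lemma twist_power: "twist z (s ^ n) = twist z s ^ n"
  by (induction n) (simp_all add: twist_mult)

lemma degree_twist [simp]: "z \<noteq> 0 \<Longrightarrow> degree (twist z s) = degree s" for z :: "'b::idom"
  by (simp add: twist_def degree_pcompose)

lemma twist_kummer_poly:
  assumes "n > 0" "z ^ n = 1"
  shows "twist z (kummer_poly n c) = kummer_poly n c"
  using assms by (intro poly_eqI) (auto simp: coeff_twist coeff_kummer_poly)

lemma twist_mod:
  fixes h :: "'b::field poly"
  assumes "twist z h = h" "z \<noteq> 0"
  shows "twist z (s mod h) = twist z s mod h"
proof (cases "h = 0")
  case False
  have "twist z s = twist z (s div h) * h + twist z (s mod h)"
    by (metis assms(1) div_mult_mod_eq twist_add twist_mult)
  then have "twist z s mod h = twist z (s mod h) mod h" by simp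
  also have "\<dots> = twist z (s mod h)"
  proof (cases "s mod h = 0")
    case True
    then show ?thesis by (simp add: twist_def)
  next
    case nonzero: False
    then show ?thesis using degree_mod_less[OF False, of s] assms(2) by (simp add: mod_poly_less)
  qed
  finally show ?thesis ..
qed simp

definition conjugates_poly :: "nat \<Rightarrow> 'b::comm_ring_1 \<Rightarrow> 'b poly \<Rightarrow> 'b poly poly" where
  "conjugates_poly n z S = (\<Prod>j<n. [:- twist (z ^ j) S, 1:])"

lemma conjugates_poly_root:
  assumes "n > 0"
  shows "poly (conjugates_poly n z S) S = 0"
  using assms by (auto simp: conjugates_poly_def poly_prod intro!: prod_zero bexI[of _ 0])

lemma lead_coeff_conjugates_poly:
  fixes z :: "'b::idom"
  shows "lead_coeff (conjugates_poly n z S) = 1"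
  by (simp add: conjugates_poly_def lead_coeff_prod)

lemma twist_coeff_conjugates_poly:
  fixes z :: "'b::idom"
  assumes "z ^ n = 1"
  shows "twist z (coeff (conjugates_poly n z S) i) = coeff (conjugates_poly n z S) i"
proof -
  let ?f = "\<lambda>j. [:- twist (z ^ j) S, 1:]"
  have "map_poly (twist z) (\<Prod>j<k. ?f j) = (\<Prod>j<k. ?f (Suc j))" for k
  proof (induction k)
    case (Suc k)
    have "map_poly (twist z) (?f k) = ?f (Suc k)"
      by (simp add: map_poly_pCons twist_uminus twist_twist)
    with Suc show ?case
      by (simp add: map_poly_hom_mult twist_add twist_mult del: mult_pCons_left mult_pCons_right)
  qed simp
  then have "map_poly (twist z) (conjugates_poly n z S) * ?f 0 = (\<Prod>j<Suc n. ?f j)"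
    by (simp only: conjugates_poly_def prod.lessThan_Suc_shift mult.commute)
  also have "\<dots> = conjugates_poly n z S * ?f 0" using assms by (simp add: conjugates_poly_def)
  finally have "map_poly (twist z) (conjugates_poly n z S) = conjugates_poly n z S"
    by (subst (asm) mult_right_cancel) auto
  then show ?thesis by (metis coeff_map_poly pcompose_0 twist_def)
qed

lemma power_diff_eq_prod_roots_of_unity:
  fixes a b z :: "'b::idom"
  assumes "n > 0" "z ^ n = 1" "inj_on (\<lambda>j. z ^ j) {..<n}"
  shows "a ^ n - b ^ n = (\<Prod>j<n. a - z ^ j * b)"
proof (cases "b = 0")
  case True
  then show ?thesis using assms(1) by (simp add: power_0_left)
next
  case False
  define P where "P = (\<Prod>j<n. [:- (z ^ j * b), 1:])"
  have "P = kummer_poly n (b ^ n)"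
  proof (rule poly_eqI_degree_lead_coeff[of _ n _ "(\<lambda>j. z ^ j * b) ` {..<n}"])
    have "inj_on (\<lambda>j. z ^ j * b) {..<n}" using assms(3) False by (auto simp: inj_on_def)
    then show "n \<le> card ((\<lambda>j. z ^ j * b) ` {..<n})" by (simp add: card_image)
    have degree_P: "degree P = n" unfolding P_def by (subst degree_prod_sum_eq) auto
    then show "degree P \<le> n" by simp
    show "degree (kummer_poly n (b ^ n)) \<le> n" using assms(1) by simp
    have "lead_coeff P = 1" by (simp add: P_def lead_coeff_prod)
    then show "coeff P n = coeff (kummer_poly n (b ^ n)) n"
      using assms(1) by (simp add: degree_P coeff_kummer_poly)
  next
    fix x assume "x \<in> (\<lambda>j. z ^ j * b) ` {..<n}"
    then obtain j where root: "j < n" "x = z ^ j * b" by auto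
    then have "poly P x = 0" by (auto simp: P_def poly_prod intro!: prod_zero bexI[of _ j])
    moreover have "(z ^ j) ^ n = 1" using assms(2) by (metis mult.commute power_mult power_one)
    ultimately show "poly P x = poly (kummer_poly n (b ^ n)) x"
      by (simp add: kummer_poly_def poly_monom root(2) power_mult_distrib)
  qed
  then have "poly P a = poly (kummer_poly n (b ^ n)) a" by simp
  then show ?thesis by (simp add: P_def kummer_poly_def poly_prod poly_monom)
qed

section \<open>Kummer extensions\<close>

locale kummer =
  fixes m :: "'a::{field,finite} poly" and l q :: nat
  assumes q_eq: "q = CARD('a)" and prime_l: "prime l" and l_dvd: "l dvd q - 1"
    and irreducible_m: "irreducible m"
begin

abbreviation "M \<equiv> to_fract m"
abbreviation "h \<equiv> kummer_poly l M"

lemma l_gt_1: "l > 1" and l_gt_0 [simp]: "l > 0"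
  using prime_gt_1_nat[OF prime_l] by auto

lemma q_gt_1: "q > 1"
  using one_less_CARD[where 'a='a] by (simp add: q_eq)

lemma h_nz [simp]: "h \<noteq> 0"
  using degree_kummer_poly[of l M] by (metis degree_0 l_gt_0 less_irrefl)

lemma degree_mod_h [simp]: "degree (s mod h) < l"
  using degree_mod_less[of h s] by auto

lemma mod_h_id: "degree s < l \<Longrightarrow> s mod h = s"
  by (simp add: mod_poly_less)

lemma monom_mod_h: "monom c k mod h = monom (c * M ^ (k div l)) (k mod l)"
proof -
  have "[monom 1 l = [:M:]] (mod h)" by (simp add: kummer_poly_def cong_iff_dvd_diff)
  then have "[monom 1 l ^ (k div l) * monom c (k mod l) = [:M:] ^ (k div l) * monom c (k mod l)] (mod h)"
    by (intro cong_mult cong_pow cong_refl)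
  moreover have "monom 1 l ^ (k div l) * monom c (k mod l) = monom c k"
    by (simp add: monom_power mult_monom)
  moreover have "[:M:] ^ (k div l) * monom c (k mod l) = monom (c * M ^ (k div l)) (k mod l)"
    by (simp add: poly_const_pow smult_monom mult.commute)
  moreover have "degree (monom (c * M ^ (k div l)) (k mod l)) < l"
    by (rule le_less_trans[OF degree_monom_le]) simp
  ultimately show ?thesis by (simp add: cong_def mod_h_id)
qed

lemma mod_h_eq_sum: "s mod h = (\<Sum>i\<le>degree s. monom (coeff s i * M ^ (i div l)) (i mod l))"
  using poly_as_sum_of_monoms[of s] by (metis (no_types, lifting) monom_mod_h poly_mod_sum sum.cong)

definition reduce :: "'a poly poly \<Rightarrow> 'a poly poly" where
  "reduce S = pseudo_mod S (kummer_poly l m)"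

lemma fract_poly_reduce: "fract_poly (reduce S) = fract_poly S mod h"
  using fract_poly_pseudo_mod[of "kummer_poly l m" S] by (simp add: reduce_def coeff_kummer_poly)

lemma degree_reduce [simp]: "degree (reduce S) < l"
  using degree_mod_h[of "fract_poly S"] by (simp flip: fract_poly_reduce)

lemma reduce_id: "degree S < l \<Longrightarrow> reduce S = S"
  using mod_h_id[of "fract_poly S"] by (simp flip: fract_poly_reduce)

lemma reduce_diff: "reduce (S - T) = reduce S - reduce T"
  and reduce_smult: "reduce (smult a S) = smult a (reduce S)"
  and reduce_mult_reduce: "reduce (S * reduce T) = reduce (S * T)"
  by (rule fract_poly_eq_iff[THEN iffD1],
      simp add: fract_poly_reduce poly_mod_diff_left mod_smult_left mod_mult_right_eq)+

definition frob_exp :: "nat \<Rightarrow> nat" where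
  "frob_exp k = (q ^ k - 1) div l"

lemma q_power_eq: "q ^ k = l * frob_exp k + 1"
proof -
  have "l dvd q ^ k - 1" using l_dvd minus_one_dvd_power_minus_one[of q k] by (rule dvd_trans)
  then show ?thesis using q_gt_1 by (simp add: frob_exp_def)
qed

lemma frob_exp_ge: "frob_exp k \<ge> k"
proof (induction k)
  case (Suc k)
  have "l * frob_exp k + 1 < q * (l * frob_exp k + 1)" using q_gt_1 by (intro n_less_m_mult_n) auto
  also have "\<dots> = l * frob_exp (Suc k) + 1" using q_power_eq[of "Suc k"] q_power_eq[of k] by simp
  finally have "frob_exp k < frob_exp (Suc k)" by simp
  with Suc show ?case by simp
qed simp

text \<open>The $q^k$-power map is diagonal on the basis $1, X, \dots, X^{l-1}$,
  because $q \equiv 1$ modulo $l$.\<close>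
lemma frobenius_coeff:
  assumes "degree s < l" "i < l"
  shows "coeff (s ^ (q ^ k) mod h) i = coeff s i ^ (q ^ k) * M ^ (i * frob_exp k)"
proof -
  have div_mod_exponent: "i * q ^ k div l = i * frob_exp k" "i * q ^ k mod l = i" if "i < l" for i
  proof -
    have "i * q ^ k = i + l * (i * frob_exp k)" by (simp add: q_power_eq algebra_simps)
    with that show "i * q ^ k div l = i * frob_exp k" "i * q ^ k mod l = i" by simp_all
  qed
  have "s ^ (q ^ k) = (\<Sum>i<l. monom (coeff s i) i ^ (q ^ k))"
    by (subst poly_eq_sum_monom[OF assms(1), symmetric]) (simp add: q_eq sum_power_CARD)
  then have "s ^ (q ^ k) mod h = (\<Sum>i<l. monom (coeff s i ^ (q ^ k) * M ^ (i * frob_exp k)) i)"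
    by (simp add: poly_mod_sum monom_power monom_mod_h div_mod_exponent)
  then show ?thesis using assms(2) by (simp add: coeff_sum)
qed

lemma mem_OK_iff: "x \<in> OK h \<longleftrightarrow> degree x < l \<and> (\<exists>p. lead_coeff p = 1 \<and> int_eval p x mod h = 0)"
  by (simp add: OK_def Kset_def int_eval_def to_fract_def)

lemma integral_bounded_denominatorsE:
  assumes integral_equation: "lead_coeff p = 1" "int_eval p x mod h = 0"
  obtains d where "d \<noteq> 0" "\<And>k. smult (to_fract d) (x ^ k) mod h \<in> range fract_poly"
proof -
  obtain d Y where denominator: "d \<noteq> 0" "smult (to_fract d) x = fract_poly Y"
    by (rule fract_poly_common_denominatorE)
  let ?n = "degree p"
  have "smult (to_fract (d ^ ?n)) (x ^ k) mod h \<in> range fract_poly" for k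
  proof -
    define r where "r = pseudo_mod (monom 1 k) p"
    have degree_r: "degree r \<le> ?n"
      using pseudo_mod_eq_0_or_degree_less[OF integral_equation(1), of "monom 1 k"]
      by (auto simp: r_def)
    obtain s where "monom 1 k - r = p * s"
      using dvd_diff_pseudo_mod[OF integral_equation(1)] unfolding r_def by blast
    then have "x ^ k - int_eval r x = int_eval p x * int_eval s x"
      by (simp flip: int_eval_diff int_eval_mult int_eval_monom_1)
    moreover have "h dvd int_eval p x" using integral_equation(2) by (rule mod_0_imp_dvd)
    ultimately have "x ^ k mod h = int_eval r x mod h" by (simp add: mod_eq_dvd_iff)
    then have "smult (to_fract (d ^ ?n)) (x ^ k) mod h = smult (to_fract (d ^ ?n)) (int_eval r x) mod h"
      by (simp only: mod_smult_left)
    also have "smult (to_fract (d ^ ?n)) (int_eval r x) =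
        (\<Sum>i\<le>?n. smult (to_fract (coeff r i * d ^ (?n - i))) (smult (to_fract d) x ^ i))"
      unfolding int_eval_eq_sum[OF degree_r] smult_sum_right
      by (intro sum.cong refl) (simp add: smult_power mult_ac flip: power_add)
    also have "\<dots> = fract_poly (\<Sum>i\<le>?n. smult (coeff r i * d ^ (?n - i)) (Y ^ i))"
      by (simp add: denominator(2))
    finally show ?thesis by (simp only: fract_poly_reduce[symmetric] rangeI)
  qed
  with denominator(1) show thesis by (intro that[of "d ^ ?n"]) auto
qed

lemma coeff_integral_if_bounded_denominators:
  assumes denominator: "d \<noteq> 0" "\<And>k. smult (to_fract d) (x ^ k) mod h \<in> range fract_poly"
    and "degree x < l"
  shows "coeff x i \<in> range to_fract"
proof (cases "coeff x i = 0")
  case True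
  then show ?thesis by (metis rangeI to_fract_0)
next
  case False
  let ?c = "coeff x i"
  let ?w = "?c ^ l * M ^ i"
  have i_less: "i < l" using False assms(3) le_degree le_less_trans by blast
  obtain a b where fraction: "?c = to_fract a / to_fract b" "b \<noteq> 0"
    by (cases ?c) (auto simp: Fract_conv_to_fract)
  have "?w \<in> range to_fract"
  proof (rule integral_fract_if_bounded_denominators)
    show "d * a \<noteq> 0" using denominator(1) fraction False by auto
    fix N
    obtain S where S_eq: "smult (to_fract d) (x ^ (q ^ N)) mod h = fract_poly S"
      using denominator(2) by blast
    have "to_fract (coeff S i) = to_fract d * (?c ^ (q ^ N) * M ^ (i * frob_exp N))"
      using frobenius_coeff[OF assms(3) i_less]
      by (simp add: mod_smult_left flip: coeff_fract_poly S_eq)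
    also have "?c ^ (q ^ N) * M ^ (i * frob_exp N) = ?c * ?w ^ frob_exp N"
      by (simp add: q_power_eq power_mult power_mult_distrib)
    finally have "to_fract (d * a) * ?w ^ frob_exp N = to_fract (b * coeff S i)"
      using fraction by (simp add: mult_ac)
    then show "\<exists>n\<ge>N. to_fract (d * a) * ?w ^ n \<in> range to_fract" using frob_exp_ge by blast
  qed
  then show ?thesis by (rule integral_fract_if_power_mult_irreducible[OF irreducible_m i_less])
qed

subsection \<open>The ring of integers\<close>

definition zeta :: 'a where
  "zeta = (SOME z. z ^ l = 1 \<and> z \<noteq> 1)"

lemma zeta_power_l: "zeta ^ l = 1" and zeta_neq_1: "zeta \<noteq> 1"
proof -
  have "\<exists>z :: 'a. z ^ l = 1 \<and> z \<noteq> 1"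
    using finite_field_root_of_unityE[OF prime_l, where 'a='a] l_dvd unfolding q_eq by blast
  then show "zeta ^ l = 1" "zeta \<noteq> 1" unfolding zeta_def by (metis (mono_tags, lifting) someI_ex)+
qed

lemma reduce_eq_const_if_twist_invariant:
  assumes "twist [:zeta:] T = T"
  shows "reduce T = [:coeff (reduce T) 0:]"
proof (rule poly_eqI)
  fix k
  show "coeff (reduce T) k = coeff [:coeff (reduce T) 0:] k"
  proof (cases k)
    case (Suc k')
    have "coeff T i = 0" if "\<not> l dvd i" for i
    proof -
      have "[:zeta:] ^ i \<noteq> 1"
        using power_root_of_unity_eq_1_iff[OF prime_l zeta_power_l zeta_neq_1, of i] that
        by (simp add: poly_const_pow one_pCons)
      moreover have "[:zeta:] ^ i * coeff T i = coeff T i" using assms coeff_twist by metis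
      ultimately show ?thesis by simp
    qed
    then have "coeff (monom (to_fract (coeff T i) * M ^ (i div l)) (i mod l)) k = 0" for i
      using Suc by (auto simp: dvd_eq_mod_eq_0)
    then have "coeff (fract_poly (reduce T)) k = 0"
      unfolding fract_poly_reduce mod_h_eq_sum
      by (simp only: coeff_sum coeff_fract_poly sum.neutral_const)
    then show ?thesis using Suc by simp
  qed simp
qed

lemma fract_poly_in_OK:
  assumes "degree S < l"
  shows "fract_poly S \<in> OK h"
proof -
  let ?P = "conjugates_poly l [:zeta:] S"
  define p where "p = map_poly (\<lambda>c. coeff (reduce c) 0) ?P"
  have reduce_0: "reduce 0 = 0" and reduce_1: "reduce 1 = 1"
    using l_gt_1 by (simp_all add: reduce_id)
  have monic: "lead_coeff ?P = 1" by (rule lead_coeff_conjugates_poly)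
  have degree_p: "degree p = degree ?P"
    unfolding p_def by (rule map_poly_degree_eq) (simp add: monic reduce_1)
  have "reduce (coeff ?P i) = [:coeff p i:]" for i
    using reduce_eq_const_if_twist_invariant[OF twist_coeff_conjugates_poly[of "[:zeta:]" l S i]]
      zeta_power_l
    by (simp add: p_def coeff_map_poly reduce_0 poly_const_pow flip: one_pCons)
  then have "smult (to_fract (coeff p i)) (fract_poly S ^ i) =
      fract_poly (reduce (coeff ?P i)) * fract_poly S ^ i" for i
    by (simp add: map_poly_pCons)
  then have "smult (to_fract (coeff p i)) (fract_poly S ^ i) mod h =
      fract_poly (coeff ?P i * S ^ i) mod h" for i
    by (simp add: fract_poly_reduce mod_mult_left_eq)
  then have "int_eval p (fract_poly S) mod h = fract_poly (\<Sum>i\<le>degree ?P. coeff ?P i * S ^ i) mod h"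
    by (simp only: int_eval_eq_sum[of p, OF order.refl] degree_p poly_mod_sum fract_poly_sum)
  also have "\<dots> = 0" using conjugates_poly_root[of l "[:zeta:]" S] by (simp add: poly_altdef)
  finally have "int_eval p (fract_poly S) mod h = 0" .
  moreover have "lead_coeff p = 1"
    unfolding degree_p by (simp add: p_def coeff_map_poly reduce_0 monic reduce_1)
  ultimately show ?thesis using assms unfolding mem_OK_iff by auto
qed

lemma OK_eq: "OK h = fract_poly ` {S. degree S < l}"
proof (intro equalityI subsetI)
  fix x assume "x \<in> OK h"
  then obtain p where degree_x: "degree x < l"
    and integral_equation: "lead_coeff p = 1" "int_eval p x mod h = 0"
    by (auto simp: mem_OK_iff)
  obtain d where "d \<noteq> 0" "\<And>k. smult (to_fract d) (x ^ k) mod h \<in> range fract_poly"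
    using integral_bounded_denominatorsE[OF integral_equation] by blast
  then have "\<forall>i. \<exists>a. coeff x i = to_fract a"
    using coeff_integral_if_bounded_denominators[OF _ _ degree_x] by blast
  then obtain a where coeff_eq: "coeff x i = to_fract (a i)" for i by metis
  have "x = fract_poly (\<Sum>i<l. monom (a i) i)"
    by (simp add: map_poly_monom poly_eq_sum_monom[OF degree_x] flip: coeff_eq)
  moreover have "degree (\<Sum>i<l. monom (a i) i) < l"
    by (intro degree_sum_less) (auto intro: le_less_trans[OF degree_monom_le])
  ultimately show "x \<in> fract_poly ` {S. degree S < l}" by blast
qed (auto intro: fract_poly_in_OK)

lemma OK_degree: "x \<in> OK h \<Longrightarrow> degree x < l"
  by (auto simp: OK_eq)

lemma OK_0 [simp]: "0 \<in> OK h" and OK_1 [simp]: "1 \<in> OK h"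
  using fract_poly_in_OK[of 0] fract_poly_in_OK[of 1] by simp_all

lemma OK_uminus: "x \<in> OK h \<Longrightarrow> - x \<in> OK h"
  by (auto simp: OK_eq simp flip: fract_poly_uminus)

lemma OK_add: "x \<in> OK h \<Longrightarrow> y \<in> OK h \<Longrightarrow> x + y \<in> OK h"
  by (auto simp: OK_eq degree_add_less simp flip: fract_poly_add)

lemma OK_mult: "x \<in> OK h \<Longrightarrow> y \<in> OK h \<Longrightarrow> (x * y) mod h \<in> OK h"
  by (auto simp: OK_eq simp flip: fract_poly_mult fract_poly_reduce)

lemma OK_ring_simps [simp]:
  "carrier (OK_ring h) = OK h" "x \<otimes>\<^bsub>OK_ring h\<^esub> y = (x * y) mod h" "x \<oplus>\<^bsub>OK_ring h\<^esub> y = x + y"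
  "\<one>\<^bsub>OK_ring h\<^esub> = 1" "\<zero>\<^bsub>OK_ring h\<^esub> = 0"
  by (simp_all add: OK_ring_def Kring_def)

lemma cring_OK_ring: "cring (OK_ring h)"
proof (rule cringI)
  show "abelian_group (OK_ring h)"
  proof (rule abelian_groupI)
    fix x assume "x \<in> carrier (OK_ring h)"
    then show "\<exists>y\<in>carrier (OK_ring h). y \<oplus>\<^bsub>OK_ring h\<^esub> x = \<zero>\<^bsub>OK_ring h\<^esub>"
      by (intro bexI[of _ "- x"]) (auto simp: OK_uminus)
  qed (auto simp: OK_add algebra_simps)
  show "Group.comm_monoid (OK_ring h)"
    by (rule comm_monoidI) (auto simp: OK_mult mod_mult_left_eq mod_mult_right_eq
        mult_ac mod_h_id OK_degree)
qed (auto simp: distrib_right poly_mod_add_left)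

lemma OK_ring_minus: "y \<in> OK h \<Longrightarrow> x \<ominus>\<^bsub>OK_ring h\<^esub> y = x - y"
proof -
  assume in_OK: "y \<in> OK h"
  interpret cring "OK_ring h" by (rule cring_OK_ring)
  have "\<ominus>\<^bsub>OK_ring h\<^esub> y = - y" using in_OK by (intro minus_equality) (auto simp: OK_uminus)
  then show ?thesis by (simp add: a_minus_def)
qed

abbreviation OK_PIdl :: "'a poly \<Rightarrow> 'a poly fract poly set" where
  "OK_PIdl g \<equiv> PIdl\<^bsub>OK_ring h\<^esub> [:to_fract g:]"

lemma ideal_OK_PIdl: "ideal (OK_PIdl g) (OK_ring h)"
  using fract_poly_in_OK[of "[:g:]"]
  by (intro cring.cgenideal_ideal[OF cring_OK_ring]) (simp add: map_poly_pCons)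

lemma fract_poly_in_OK_PIdl_iff:
  assumes "degree S < l"
  shows "fract_poly S \<in> OK_PIdl g \<longleftrightarrow> [:g:] dvd S"
proof
  assume "fract_poly S \<in> OK_PIdl g"
  then obtain T where "degree T < l" "fract_poly S = (fract_poly T * [:to_fract g:]) mod h"
    by (auto simp: cgenideal_def OK_eq)
  then have "fract_poly S = fract_poly (reduce (smult g T))" by (simp add: fract_poly_reduce)
  then have "S = smult g (reduce T)" by (simp only: fract_poly_eq_iff reduce_smult)
  then show "[:g:] dvd S" by (simp add: const_poly_dvd_iff)
next
  assume "[:g:] dvd S"
  then obtain T where S_eq: "S = smult g T" by auto
  have "fract_poly S = fract_poly (reduce S)" using assms by (simp add: reduce_id)
  also have "\<dots> = (fract_poly (reduce T) * [:to_fract g:]) mod h"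
    by (simp add: S_eq reduce_smult fract_poly_reduce mod_smult_left)
  finally have "fract_poly S = (fract_poly (reduce T) * [:to_fract g:]) mod h" .
  then show "fract_poly S \<in> OK_PIdl g"
    unfolding cgenideal_def OK_ring_simps using fract_poly_in_OK[OF degree_reduce] by blast
qed

lemma fract_poly_diff_in_OK_PIdl_iff:
  assumes "degree S < l" "degree T < l"
  shows "fract_poly S \<ominus>\<^bsub>OK_ring h\<^esub> fract_poly T \<in> OK_PIdl g \<longleftrightarrow> [:g:] dvd S - T"
  using assms fract_poly_in_OK_PIdl_iff[of "S - T" g]
  by (simp add: OK_ring_minus fract_poly_in_OK degree_diff_less)

definition Quot_representatives :: "'a poly \<Rightarrow> 'a poly poly set" where
  "Quot_representatives g = {S. degree S < l \<and> (\<forall>i. degree (coeff S i) < degree g)}"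

lemma
  assumes "degree g > 0"
  shows finite_Quot_representatives: "finite (Quot_representatives g)"
    and card_Quot_representatives: "card (Quot_representatives g) = q ^ (l * degree g)"
proof -
  let ?C = "{a :: 'a poly. degree a < degree g}"
  have "finite ?C" "card ?C = q ^ degree g"
    using finite_polys_degree_less[OF assms] card_polys_degree_less[OF assms]
    by (simp_all add: q_eq)
  moreover have "0 \<in> ?C" using assms by simp
  moreover have "k < l \<longleftrightarrow> k \<le> l - 1" for k using l_gt_0 by linarith
  then have "Quot_representatives g = {S. degree S \<le> l - 1 \<and> (\<forall>i. coeff S i \<in> ?C)}"
    by (simp add: Quot_representatives_def)
  moreover have "(q ^ degree g) ^ Suc (l - 1) = q ^ (l * degree g)"
    by (simp add: mult.commute flip: power_mult)
  ultimately show "finite (Quot_representatives g)" "card (Quot_representatives g) = q ^ (l * degree g)"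
    using finite_polys_degree_le[of ?C "l - 1"] card_polys_degree_le[of ?C "l - 1"] by simp_all
qed

lemma bij_betw_Quot_representatives:
  assumes "degree g > 0"
  shows "bij_betw (\<lambda>x. OK_PIdl g +>\<^bsub>OK_ring h\<^esub> x) (fract_poly ` Quot_representatives g)
    (carrier (OK_ring h Quot OK_PIdl g))"
proof (rule bij_betw_representatives_Quot[OF ideal_OK_PIdl])
  show "fract_poly ` Quot_representatives g \<subseteq> carrier (OK_ring h)"
    by (auto simp: Quot_representatives_def intro: fract_poly_in_OK)
next
  fix x assume "x \<in> carrier (OK_ring h)"
  then obtain S where x_eq: "x = fract_poly S" and degree_S: "degree S < l" by (auto simp: OK_eq)
  define T where "T = map_poly (\<lambda>a. a mod g) S"
  have "degree (a mod g) < degree g" for a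
    using degree_mod_less[of g a] assms by (cases "g = 0") auto
  moreover have "degree T \<le> degree S" unfolding T_def by (rule map_poly_degree_leq)
  ultimately have "T \<in> Quot_representatives g" and "degree T < l"
    using degree_S by (auto simp: Quot_representatives_def T_def coeff_map_poly)
  moreover have "[:g:] dvd S - T" by (simp add: const_poly_dvd_iff T_def coeff_map_poly)
  ultimately show "\<exists>t\<in>fract_poly ` Quot_representatives g. x \<ominus>\<^bsub>OK_ring h\<^esub> t \<in> OK_PIdl g"
    using degree_S x_eq fract_poly_diff_in_OK_PIdl_iff[of S T] by blast
next
  fix s t assume "s \<in> fract_poly ` Quot_representatives g" "t \<in> fract_poly ` Quot_representatives g"
    and cong: "s \<ominus>\<^bsub>OK_ring h\<^esub> t \<in> OK_PIdl g"
  then obtain S T where eqs: "s = fract_poly S" "t = fract_poly T"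
    and reps: "S \<in> Quot_representatives g" "T \<in> Quot_representatives g" by blast
  then have "[:g:] dvd S - T"
    using cong by (simp add: Quot_representatives_def fract_poly_diff_in_OK_PIdl_iff)
  then have "g dvd coeff S i - coeff T i" for i by (simp add: const_poly_dvd_iff)
  moreover have "degree (coeff S i - coeff T i) < degree g" for i
    using reps by (intro degree_diff_less) (auto simp: Quot_representatives_def)
  ultimately have "coeff S i - coeff T i = 0" for i by (metis dvd_imp_degree_le not_less)
  then show "s = t" by (simp add: eqs poly_eq_iff)
qed

lemma
  assumes "degree g > 0"
  shows finite_OK_Quot: "finite (carrier (OK_ring h Quot OK_PIdl g))"
    and card_OK_Quot: "card (carrier (OK_ring h Quot OK_PIdl g)) = q ^ (l * degree g)"
proof -
  have "card (fract_poly ` Quot_representatives g) = card (Quot_representatives g)"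
    by (rule card_image) (simp add: inj_on_def)
  then show "finite (carrier (OK_ring h Quot OK_PIdl g))"
    "card (carrier (OK_ring h Quot OK_PIdl g)) = q ^ (l * degree g)"
    using bij_betw_finite[OF bij_betw_Quot_representatives[OF assms]]
      bij_betw_same_card[OF bij_betw_Quot_representatives[OF assms]]
      finite_Quot_representatives[OF assms] card_Quot_representatives[OF assms] by simp_all
qed

subsection \<open>Inert primes\<close>

lemma const_dvd_reduce: "[:a:] dvd T \<Longrightarrow> [:a:] dvd reduce T"
  by (elim dvdE) (simp add: reduce_smult const_poly_dvd_iff)

lemma const_dvd_reduce_mult: "[:a:] dvd reduce T \<Longrightarrow> [:a:] dvd reduce (S * T)"
  using const_dvd_reduce[of a "S * reduce T"] by (simp add: reduce_mult_reduce)

lemma reduce_monom_mult: "reduce (monom c l * S) = smult (c * m) (reduce S)"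
proof -
  have "fract_poly (reduce (monom c l)) = fract_poly [:c * m:]"
    by (simp add: fract_poly_reduce map_poly_monom monom_mod_h monom_0 map_poly_pCons)
  then have "reduce (monom c l) = [:c * m:]" by (simp only: fract_poly_eq_iff)
  then show ?thesis
    using reduce_mult_reduce[of S "monom c l"] by (simp add: mult.commute reduce_smult)
qed

lemma coeff_reduce_frobenius:
  assumes "degree R < l" "i < l"
  shows "coeff (reduce (R ^ (q ^ k))) i = coeff R i ^ (q ^ k) * m ^ (i * frob_exp k)"
proof -
  have "to_fract (coeff (reduce (R ^ (q ^ k))) i) = to_fract (coeff R i ^ (q ^ k) * m ^ (i * frob_exp k))"
    using frobenius_coeff[of "fract_poly R" i k] assms
    by (simp add: fract_poly_reduce flip: coeff_fract_poly)
  then show ?thesis by (simp only: to_fract_eq_iff)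
qed

end

locale kummer_inert = kummer +
  fixes p :: "'a poly"
  assumes irreducible_p: "irreducible p" and p_not_dvd_m: "\<not> p dvd m"
    and nonresidue: "\<not> p dvd m ^ ((q ^ degree p - 1) div l) - 1"
begin

abbreviation "residue_symbol \<equiv> m ^ frob_exp (degree p)"

lemma prime_p: "prime_elem p"
  using irreducible_p by (rule field_poly_irreducible_imp_prime)

lemma degree_p_pos: "degree p > 0"
  using irreducible_p by (rule irreducible_field_poly_degree_pos)

lemma not_dvd_residue_symbol_power_diff:
  assumes "i < l" "j < l" "i \<noteq> j"
  shows "\<not> p dvd residue_symbol ^ i - residue_symbol ^ j"
proof
  have "residue_symbol ^ l = m ^ (q ^ degree p - 1)"
    by (simp add: q_power_eq mult.commute flip: power_mult)
  then have "p dvd residue_symbol ^ l - 1"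
    using poly_fermat[OF irreducible_p p_not_dvd_m] by (simp add: q_eq)
  moreover assume "p dvd residue_symbol ^ i - residue_symbol ^ j"
  ultimately have "p dvd residue_symbol - 1"
    using dvd_power_diff_imp_dvd_minus_one[OF prime_l _ assms] by blast
  with nonresidue show False by (simp add: frob_exp_def)
qed

text \<open>The ideals of $A[X]/(p, X^l - m)$ are stable under the $q^{\deg p}$-power map, whose
  eigenvalues on the powers $X^i$ are distinct modulo $p$.\<close>
lemma eliminate_coeffE:
  assumes "degree R < l" "j < l"
  obtains F where "\<And>k. k < l \<Longrightarrow> p dvd coeff (reduce (F * R)) k \<longleftrightarrow> p dvd coeff R k \<or> k = j"
proof -
  let ?Q = "q ^ degree p"
  define F where "F = R ^ (?Q - 1) - [:residue_symbol ^ j:]"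
  have "R ^ ?Q = R ^ (?Q - 1) * R" by (simp add: q_power_eq)
  then have "F * R = R ^ ?Q - smult (residue_symbol ^ j) R" by (simp add: F_def left_diff_distrib)
  then have reduce_FR: "reduce (F * R) = reduce (R ^ ?Q) - smult (residue_symbol ^ j) R"
    using assms(1) by (simp add: reduce_diff reduce_smult reduce_id)
  have "p dvd coeff (reduce (F * R)) k \<longleftrightarrow> p dvd coeff R k \<or> k = j" if "k < l" for k
  proof -
    have "coeff (reduce (F * R)) k = (coeff R k ^ ?Q - coeff R k) * residue_symbol ^ k +
        coeff R k * (residue_symbol ^ k - residue_symbol ^ j)"
      using coeff_reduce_frobenius[OF assms(1) that, of "degree p"]
      by (simp add: reduce_FR algebra_simps flip: power_mult)
    moreover have "p dvd (coeff R k ^ ?Q - coeff R k) * residue_symbol ^ k"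
      using poly_fermat_power[OF irreducible_p dvd_refl, of "coeff R k"] by (simp add: q_eq)
    ultimately have "p dvd coeff (reduce (F * R)) k \<longleftrightarrow>
        p dvd coeff R k * (residue_symbol ^ k - residue_symbol ^ j)"
      by (simp add: dvd_add_right_iff)
    also have "\<dots> \<longleftrightarrow> p dvd coeff R k \<or> k = j"
      using not_dvd_residue_symbol_power_diff[OF that assms(2)]
      by (auto simp: prime_elem_dvd_mult_iff[OF prime_p])
    finally show ?thesis .
  qed
  then show thesis by (rule that)
qed

abbreviation support_mod_p :: "'a poly poly \<Rightarrow> nat set" where
  "support_mod_p R \<equiv> {k. \<not> p dvd coeff R k}"

lemma support_mod_p_subset: "degree R < l \<Longrightarrow> support_mod_p R \<subseteq> {..<l}"
  by (auto intro: ccontr simp: coeff_eq_0)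

lemma smaller_support_multipleE:
  assumes "degree R < l" "i \<in> support_mod_p R" "j \<in> support_mod_p R" "i \<noteq> j"
  obtains F where "support_mod_p (reduce (F * R)) \<subset> support_mod_p R" "i \<in> support_mod_p (reduce (F * R))"
proof -
  have less_l: "k < l" if "k \<in> support_mod_p R" for k
    using support_mod_p_subset[OF assms(1)] that by blast
  obtain F where eliminated: "\<And>k. k < l \<Longrightarrow> p dvd coeff (reduce (F * R)) k \<longleftrightarrow> p dvd coeff R k \<or> k = j"
    using assms(1) less_l[OF assms(3)] by (rule eliminate_coeffE) blast
  have "support_mod_p (reduce (F * R)) \<subseteq> support_mod_p R - {j}"
    using support_mod_p_subset[OF degree_reduce, of "F * R"] eliminated by auto
  with assms(3) have "support_mod_p (reduce (F * R)) \<subset> support_mod_p R" by blast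
  moreover have "i \<in> support_mod_p (reduce (F * R))"
    using eliminated[OF less_l[OF assms(2)]] assms(2,4) by simp
  ultimately show thesis by (rule that)
qed

lemma monomial_multipleE:
  assumes "degree R < l" "\<not> [:p:] dvd R"
  obtains F i where "i < l" "\<not> p dvd coeff (reduce (F * R)) i"
    "[:p:] dvd reduce (F * R) - monom (coeff (reduce (F * R)) i) i"
proof -
  have "\<exists>F i. support_mod_p (reduce (F * R)) = {i}"
    using assms
  proof (induction "card (support_mod_p R)" arbitrary: R rule: less_induct)
    case less
    obtain i where i_supp: "i \<in> support_mod_p R" using less.prems(2) by (auto simp: const_poly_dvd_iff)
    show ?case
    proof (cases "support_mod_p R = {i}")
      case True
      then show ?thesis using less.prems(1) by (intro exI[of _ 1] exI[of _ i]) (simp add: reduce_id)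
    next
      case False
      with i_supp obtain j where "j \<in> support_mod_p R" "i \<noteq> j" by blast
      with less.prems(1) i_supp obtain F where smaller:
        "support_mod_p (reduce (F * R)) \<subset> support_mod_p R" "i \<in> support_mod_p (reduce (F * R))"
        by (rule smaller_support_multipleE)
      have "finite (support_mod_p R)"
        using support_mod_p_subset[OF less.prems(1)] by (rule finite_subset) simp
      then have "card (support_mod_p (reduce (F * R))) < card (support_mod_p R)"
        using smaller(1) by (rule psubset_card_mono)
      moreover have "\<not> [:p:] dvd reduce (F * R)" using smaller(2) by (auto simp: const_poly_dvd_iff)
      ultimately obtain G k where "support_mod_p (reduce (G * reduce (F * R))) = {k}"
        using less.hyps[of "reduce (F * R)"] degree_reduce by blast
      then show ?thesis
        unfolding reduce_mult_reduce by (intro exI[of _ "G * F"] exI[of _ k]) (simp add: mult.assoc)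
    qed
  qed
  then obtain F i where singleton: "support_mod_p (reduce (F * R)) = {i}" by blast
  show thesis
  proof (rule that)
    show "i < l" using support_mod_p_subset[OF degree_reduce, of "F * R"] singleton by simp
    show "\<not> p dvd coeff (reduce (F * R)) i" using singleton by blast
    show "[:p:] dvd reduce (F * R) - monom (coeff (reduce (F * R)) i) i"
      using singleton by (auto simp: const_poly_dvd_iff)
  qed
qed

lemma const_dvd_reduce_multD:
  assumes "[:p:] dvd reduce (R * S)" "degree R < l" "degree S < l"
  shows "[:p:] dvd R \<or> [:p:] dvd S"
proof (intro disjCI)
  assume "\<not> [:p:] dvd S"
  with assms(3) obtain F i where monomial: "i < l" "\<not> p dvd coeff (reduce (F * S)) i"
    "[:p:] dvd reduce (F * S) - monom (coeff (reduce (F * S)) i) i"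
    by (rule monomial_multipleE)
  let ?c = "coeff (reduce (F * S)) i"
  have "[:p:] dvd reduce (R * reduce (F * S))"
    using const_dvd_reduce_mult[OF assms(1), of F] by (simp add: reduce_mult_reduce mult_ac)
  moreover have "[:p:] dvd reduce (R * (reduce (F * S) - monom ?c i))"
    using monomial(3) by (intro const_dvd_reduce_mult const_dvd_reduce)
  ultimately have "[:p:] dvd reduce (R * reduce (F * S)) - reduce (R * (reduce (F * S) - monom ?c i))"
    by (rule dvd_diff)
  then have "[:p:] dvd reduce (R * monom ?c i)" by (simp add: right_diff_distrib flip: reduce_diff)
  then have "[:p:] dvd reduce (monom 1 (l - i) * (R * monom ?c i))" by (rule const_dvd_reduce_mult)
  also have "monom 1 (l - i) * (R * monom ?c i) = monom ?c l * R"
    using monomial(1) by (simp add: mult_monom mult.left_commute)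
  finally have "p dvd ?c * m * coeff R k" for k
    using assms(2) by (simp add: reduce_monom_mult reduce_id const_poly_dvd_iff)
  then show "[:p:] dvd R"
    using monomial(2) p_not_dvd_m prime_p by (simp add: prime_elem_dvd_mult_iff const_poly_dvd_iff)
qed

lemma irreducible_h: "irreducible h"
proof (rule irreducibleI)
  show "\<not> h dvd 1" by (simp add: is_unit_iff_degree)
  fix f k assume h_eq: "h = f * k"
  show "f dvd 1 \<or> k dvd 1"
  proof (rule ccontr)
    assume "\<not> (f dvd 1 \<or> k dvd 1)"
    moreover have nonzero: "f \<noteq> 0" "k \<noteq> 0" using h_eq h_nz by auto
    ultimately have "degree f > 0" "degree k > 0" by (auto simp: is_unit_iff_degree)
    moreover have "degree f + degree k = l" using nonzero by (simp flip: h_eq degree_mult_eq)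
    ultimately have degrees: "degree f < l" "degree k < l" by auto
    obtain c F where primitive_F: "c \<noteq> 0" "smult c f = fract_poly F" "\<not> [:p:] dvd F"
      using nonzero(1) irreducible_p by (rule fract_poly_primitive_multipleE)
    obtain d K where primitive_K: "d \<noteq> 0" "smult d k = fract_poly K" "\<not> [:p:] dvd K"
      using nonzero(2) irreducible_p by (rule fract_poly_primitive_multipleE)
    have "fract_poly (F * K) = smult (c * d) h"
      by (simp add: h_eq mult.commute flip: primitive_F(2) primitive_K(2))
    then have "fract_poly (reduce (F * K)) = 0"
      by (simp only: fract_poly_reduce mod_smult_left mod_self smult_0_right)
    then have "[:p:] dvd reduce (F * K)" by simp
    moreover have "degree (fract_poly F) < l" "degree (fract_poly K) < l"
      using degrees primitive_F(1) primitive_K(1) by (simp_all flip: primitive_F(2) primitive_K(2))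
    ultimately show False using const_dvd_reduce_multD[of F K] primitive_F(3) primitive_K(3) by simp
  qed
qed simp

lemma field_OK_Quot: "field (OK_ring h Quot OK_PIdl p)"
proof -
  have "1 \<notin> OK_PIdl p"
    using fract_poly_in_OK_PIdl_iff[of 1 p] irreducible_p
    by (auto simp: const_poly_dvd_iff irreducible_not_unit dest: spec[of _ 0])
  then have "carrier (OK_ring h) \<noteq> OK_PIdl p" by auto
  moreover have "x \<in> OK_PIdl p \<or> y \<in> OK_PIdl p"
    if product: "x \<in> OK h" "y \<in> OK h" "(x * y) mod h \<in> OK_PIdl p" for x y
  proof -
    obtain S T where representatives: "x = fract_poly S" "degree S < l" "y = fract_poly T" "degree T < l"
      using product(1,2) by (auto simp: OK_eq)
    have "fract_poly (reduce (S * T)) \<in> OK_PIdl p"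
      using product(3) representatives by (simp add: fract_poly_reduce)
    then have "[:p:] dvd reduce (S * T)" by (simp add: fract_poly_in_OK_PIdl_iff)
    then show ?thesis
      using const_dvd_reduce_multD representatives by (simp add: fract_poly_in_OK_PIdl_iff)
  qed
  ultimately have "primeideal (OK_PIdl p) (OK_ring h)"
    by (intro primeidealI ideal_OK_PIdl cring_OK_ring) auto
  then show ?thesis
    using finite_OK_Quot[OF degree_p_pos]
    by (intro domain.field_if_finite primeideal.quotient_is_domain)
qed

lemma not_carmichael_in:
  assumes "p dvd g" "degree g > 0" and obstruction: "g = p \<or> \<not> degree p dvd degree g"
  shows "\<not> carmichael_in h g"
proof
  assume "carmichael_in h g"
  then have carmichael: "carmichael_ring (OK_ring h Quot OK_PIdl g)"
    by (simp add: carmichael_in_def carmichael_ideal_def to_fract_def)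
  show False
  proof (cases "g = p")
    case True
    with carmichael field_OK_Quot show False by (simp add: carmichael_ring_def)
  next
    case False
    have "OK_PIdl g \<subseteq> OK_PIdl p"
    proof
      fix x assume "x \<in> OK_PIdl g"
      moreover have "OK_PIdl g \<subseteq> OK h"
        using additive_subgroup.a_subset[OF ideal.axioms(1)[OF ideal_OK_PIdl]] by simp
      ultimately obtain S where representative: "x = fract_poly S" "degree S < l" "[:g:] dvd S"
        by (auto simp: OK_eq fract_poly_in_OK_PIdl_iff)
      have "[:p:] dvd S"
        using assms(1) representative(3)
        by (rule dvd_trans[OF const_poly_dvd_const_poly_iff[THEN iffD2]])
      with representative show "x \<in> OK_PIdl p" by (simp add: fract_poly_in_OK_PIdl_iff)
    qed
    then have "q ^ (l * degree p) - 1 dvd q ^ (l * degree g) - 1"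
      using card_residue_field_dvd_if_carmichael[OF ideal_OK_PIdl carmichael _
          ideal_OK_PIdl field_OK_Quot]
        finite_OK_Quot[OF degree_p_pos] card_OK_Quot[OF degree_p_pos] card_OK_Quot[OF assms(2)]
          by simp
    then have "l * degree p dvd l * degree g"
      using q_gt_1 by (simp only: power_minus_one_dvd_power_minus_one_iff)
    then show False using obstruction False l_gt_1 by auto
  qed
qed

end

subsection \<open>Automorphisms and isomorphisms\<close>

lemma Kring_simps [simp]:
  "carrier (Kring h) = Kset h" "x \<otimes>\<^bsub>Kring h\<^esub> y = (x * y) mod h" "x \<oplus>\<^bsub>Kring h\<^esub> y = x + y"
  "\<one>\<^bsub>Kring h\<^esub> = 1" "\<zero>\<^bsub>Kring h\<^esub> = 0"
  by (simp_all add: Kring_def)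

lemma Kring_hom_mod:
  fixes h1 h2 :: "'a::field poly fract poly"
  assumes hom: "\<phi> \<in> ring_hom (Kring h1) (Kring h2)" and const: "\<And>c. \<phi> [:c:] = [:c:]"
    and "degree h1 > 1"
  shows "\<phi> (s mod h1) = pcompose s (\<phi> [:0, 1:]) mod h2"
proof (induction s)
  case 0
  show ?case using const[of 0] by simp
next
  case (pCons a s)
  let ?X = "[:0, 1:] :: 'a poly fract poly"
  have "h1 \<noteq> 0" using assms(3) by auto
  then have mod_carrier: "t mod h1 \<in> carrier (Kring h1)" for t
    using degree_mod_less[of h1 t] assms(3) by (auto simp: Kset_def)
  have X_carrier: "?X \<in> carrier (Kring h1)" and const_carrier: "[:a:] \<in> carrier (Kring h1)"
    using assms(3) by (simp_all add: Kset_def)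
  have "\<phi> [:a:] \<in> carrier (Kring h2)" using hom const_carrier by (rule ring_hom_closed)
  then have const_mod: "[:a:] mod h2 = [:a:]" by (simp add: const Kset_def mod_poly_less)
  have "([:a:] + ?X * s) mod h1 = [:a:] + (?X * (s mod h1)) mod h1"
    using assms(3)
    by (simp add: poly_mod_add_left mod_poly_less mod_mult_right_eq del: mult_pCons_left)
  then have "pCons a s mod h1 = [:a:] \<oplus>\<^bsub>Kring h1\<^esub> (?X * (s mod h1)) mod h1" by simp
  also have "\<phi> \<dots> = [:a:] + \<phi> (?X \<otimes>\<^bsub>Kring h1\<^esub> (s mod h1))"
    using ring_hom_add[OF hom const_carrier mod_carrier[of "?X * (s mod h1)"]] by (simp add: const)
  also have "\<phi> (?X \<otimes>\<^bsub>Kring h1\<^esub> (s mod h1)) = (\<phi> ?X * pcompose s (\<phi> ?X)) mod h2"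
    using ring_hom_mult[OF hom X_carrier mod_carrier] by (simp add: pCons.IH mod_mult_right_eq)
  finally show ?case by (simp add: pcompose_pCons poly_mod_add_left const_mod)
qed

lemma Kring_hom_kummer_root:
  assumes "\<phi> \<in> ring_hom (Kring (kummer_poly n c)) (Kring h2)" "\<And>c. \<phi> [:c:] = [:c:]" "n > 1"
  shows "[\<phi> [:0, 1:] ^ n = [:c:]] (mod h2)"
proof -
  have hom_mod: "\<phi> (s mod kummer_poly n c) = pcompose s (\<phi> [:0, 1:]) mod h2" for s
    using assms(1,2) by (rule Kring_hom_mod) (use assms(3) in simp)
  have "monom 1 n mod kummer_poly n c = [:c:] mod kummer_poly n c"
    by (simp add: kummer_poly_def mod_eq_dvd_iff)
  then have "pcompose (monom 1 n) (\<phi> [:0, 1:]) mod h2 = pcompose [:c:] (\<phi> [:0, 1:]) mod h2"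
    by (metis hom_mod)
  then show ?thesis by (simp add: cong_def pcompose_monom)
qed

lemma twist_in_Kaut:
  assumes "z ^ n = 1" "n > 0" "twist z h = h" "degree h > 0"
  shows "restrict (twist z) (Kset h) \<in> Kaut h"
proof -
  have z_nonzero: "z \<noteq> 0" using assms(1,2) by (auto simp: power_0_left)
  have in_Kset: "twist y x \<in> Kset h" if "y \<noteq> 0" "x \<in> Kset h" for x y
    using that by (simp add: Kset_def)
  have "restrict (twist z) (Kset h) \<in> ring_iso (Kring h) (Kring h)"
  proof (rule ring_iso_memI)
    have "twist (z ^ (n - 1)) (twist z x) = x" "twist z (twist (z ^ (n - 1)) x) = x" for x
      using assms(1,2) by (simp_all add: twist_twist mult.commute flip: power_Suc)
    then have "bij_betw (twist z) (Kset h) (Kset h)"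
      using z_nonzero in_Kset by (intro bij_betw_byWitness[where f' = "twist (z ^ (n - 1))"]) auto
    then show "bij_betw (restrict (twist z) (Kset h)) (carrier (Kring h)) (carrier (Kring h))"
      using bij_betw_cong[of "Kset h" "restrict (twist z) (Kset h)" "twist z" "Kset h"] by simp
  next
    fix x y assume "x \<in> carrier (Kring h)" "y \<in> carrier (Kring h)"
    moreover have "h \<noteq> 0" using assms(4) by auto
    ultimately have "x \<in> Kset h" "y \<in> Kset h" "x + y \<in> Kset h" "(x * y) mod h \<in> Kset h"
      using degree_mod_less[of h "x * y"] assms(4) by (auto simp: Kset_def intro: degree_add_less)
    then show
      "restrict (twist z) (Kset h) (x \<otimes>\<^bsub>Kring h\<^esub> y) =
        restrict (twist z) (Kset h) x \<otimes>\<^bsub>Kring h\<^esub> restrict (twist z) (Kset h) y"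
      "restrict (twist z) (Kset h) (x \<oplus>\<^bsub>Kring h\<^esub> y) =
        restrict (twist z) (Kset h) x \<oplus>\<^bsub>Kring h\<^esub> restrict (twist z) (Kset h) y"
      by (simp_all add: twist_mod[OF assms(3) z_nonzero] twist_mult twist_add)
  qed (use z_nonzero assms(4) in \<open>auto simp: in_Kset, simp add: Kset_def\<close>)
  then show ?thesis using assms(4) by (auto simp: Kaut_def Kset_def)
qed

lemma funpow_restrict_twist:
  assumes "z \<noteq> 0" "x \<in> Kset h"
  shows "(restrict (twist z) (Kset h) ^^ k) x = twist (z ^ k) x"
proof (induction k)
  case (Suc k)
  have "twist (z ^ k) x \<in> Kset h" using assms by (simp add: Kset_def)
  with Suc show ?case by (simp add: twist_twist)
qed simp

context kummer
begin

abbreviation zetaK :: "'a poly fract" where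
  "zetaK \<equiv> to_fract [:zeta:]"

lemma zetaK_power_l: "zetaK ^ l = 1" and zetaK_neq_1: "zetaK \<noteq> 1"
proof -
  have "zetaK ^ l = to_fract [:zeta ^ l:]" by (simp add: poly_const_pow flip: to_fract_power)
  then show "zetaK ^ l = 1" by (simp add: zeta_power_l flip: one_pCons)
  show "zetaK \<noteq> 1"
  proof
    assume "zetaK = 1"
    then have "to_fract [:zeta:] = to_fract [:1:]" by (simp flip: one_pCons)
    then have "[:zeta:] = [:1:]" by (simp only: to_fract_eq_iff)
    with zeta_neq_1 show False by simp
  qed
qed

lemma zeta_nz [simp]: "zeta \<noteq> 0"
  using zeta_power_l l_gt_1 by (auto simp: power_0_left)

lemma zetaK_power_power_l: "(zetaK ^ j) ^ l = 1"
  by (metis zetaK_power_l mult.commute power_mult power_one)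

lemma inj_on_zetaK_power: "inj_on (\<lambda>j. zetaK ^ j) {..<l}"
  using prime_l zetaK_power_l zetaK_neq_1 by (rule inj_on_power_root_of_unity)

lemma twist_zetaK_h: "twist (zetaK ^ j) h = h"
  using l_gt_0 zetaK_power_power_l by (rule twist_kummer_poly)

end

context kummer_inert
begin

lemma power_cong_imp_root_of_unity_multiple:
  assumes "[y ^ l = x ^ l] (mod h)" "degree x < l" "degree y < l"
  shows "\<exists>j<l. y = smult (zetaK ^ j) x"
proof -
  have "inj_on (\<lambda>j. [:zetaK:] ^ j) {..<l}"
    using inj_on_zetaK_power by (auto simp: inj_on_def poly_const_pow)
  then have "y ^ l - x ^ l = (\<Prod>j<l. y - [:zetaK:] ^ j * x)"
    using zetaK_power_l
    by (intro power_diff_eq_prod_roots_of_unity) (simp_all add: poly_const_pow flip: one_pCons)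
  then have "h dvd (\<Prod>j<l. y - [:zetaK:] ^ j * x)" using assms(1) by (simp add: cong_iff_dvd_diff)
  with field_poly_irreducible_imp_prime[OF irreducible_h]
  obtain j where root: "j < l" "h dvd y - [:zetaK:] ^ j * x"
    by (rule prime_elem_dvd_prodE) auto
  from root(2) have "y mod h = smult (zetaK ^ j) x mod h"
    by (simp add: poly_const_pow mod_eq_dvd_iff)
  then have "y = smult (zetaK ^ j) x" using assms(2,3) by (simp add: mod_h_id)
  with root(1) show ?thesis by blast
qed

lemma Kaut_eq: "Kaut h = (\<lambda>j. restrict (twist (zetaK ^ j)) (Kset h)) ` {..<l}"
proof (intro equalityI subsetI)
  fix \<tau> assume "\<tau> \<in> (\<lambda>j. restrict (twist (zetaK ^ j)) (Kset h)) ` {..<l}"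
  then show "\<tau> \<in> Kaut h"
    by (auto intro!: twist_in_Kaut[of _ l] twist_zetaK_h zetaK_power_power_l)
next
  fix \<tau> assume "\<tau> \<in> Kaut h"
  then have automorphism: "\<tau> \<in> ring_hom (Kring h) (Kring h)" "\<tau> \<in> extensional (Kset h)"
      "\<And>c. \<tau> [:c:] = [:c:]"
    by (auto simp: Kaut_def ring_iso_def)
  have X_in_Kset: "[:0, 1:] \<in> Kset h" using l_gt_1 by (simp add: Kset_def)
  have "[\<tau> [:0, 1:] ^ l = [:M:]] (mod h)"
    using automorphism(1,3) l_gt_1 by (rule Kring_hom_kummer_root)
  moreover have "[[:0, 1:] ^ l = [:M:]] (mod h)"
    by (simp add: kummer_poly_def monom_altdef cong_iff_dvd_diff)
  ultimately have "[\<tau> [:0, 1:] ^ l = [:0, 1:] ^ l] (mod h)" by (meson cong_sym cong_trans)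
  moreover have "\<tau> [:0, 1:] \<in> Kset h" using ring_hom_closed[OF automorphism(1)] X_in_Kset by simp
  ultimately obtain j where image_X: "j < l" "\<tau> [:0, 1:] = smult (zetaK ^ j) [:0, 1:]"
    using power_cong_imp_root_of_unity_multiple[of "\<tau> [:0, 1:]" "[:0, 1:]"] X_in_Kset
    by (auto simp: Kset_def)
  have "\<tau> x = twist (zetaK ^ j) x" if "x \<in> Kset h" for x
    using Kring_hom_mod[OF automorphism(1,3), of x] that l_gt_1
    by (simp add: image_X(2) twist_def Kset_def mod_h_id degree_pcompose)
  then have "\<tau> = restrict (twist (zetaK ^ j)) (Kset h)"
    using automorphism(2) by (intro extensionalityI[of _ "Kset h"]) auto
  with image_X(1) show "\<tau> \<in> (\<lambda>j. restrict (twist (zetaK ^ j)) (Kset h)) ` {..<l}" by blast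
qed

lemma cyclic_ext_h: "cyclic_ext l h"
proof -
  have X_in_Kset: "[:0, 1:] \<in> Kset h" using l_gt_1 by (simp add: Kset_def)
  have "inj_on (\<lambda>j. restrict (twist (zetaK ^ j)) (Kset h)) {..<l}"
  proof (rule inj_onI)
    fix i j assume equal_restrictions: "i \<in> {..<l}" "j \<in> {..<l}"
      "restrict (twist (zetaK ^ i)) (Kset h) = restrict (twist (zetaK ^ j)) (Kset h)"
    then have "twist (zetaK ^ i) [:0, 1:] = twist (zetaK ^ j) [:0, 1:]"
      using X_in_Kset by (metis restrict_apply')
    then have "zetaK ^ i = zetaK ^ j" by (simp add: twist_def pcompose_pCons)
    with equal_restrictions(1,2) inj_on_zetaK_power show "i = j" by (auto dest: inj_onD)
  qed
  then have "card (Kaut h) = l" by (simp add: Kaut_eq card_image)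
  moreover have "restrict (twist zetaK) (Kset h) \<in> Kaut h"
    using l_gt_1 by (auto simp: Kaut_eq intro!: image_eqI[of _ _ 1])
  moreover have "\<exists>k. \<forall>x\<in>Kset h. \<tau> x = (restrict (twist zetaK) (Kset h) ^^ k) x" if \<tau>: "\<tau> \<in> Kaut h" for \<tau>
  proof -
    obtain j where "\<tau> = restrict (twist (zetaK ^ j)) (Kset h)" using \<tau> by (auto simp: Kaut_eq)
    then show ?thesis by (intro exI[of _ j]) (simp add: funpow_restrict_twist)
  qed
  ultimately show ?thesis unfolding cyclic_ext_def using irreducible_h by auto
qed

lemma const_cong_power_imp_eq:
  assumes y_root: "[y ^ l = [:a:]] (mod h)" "degree y < l"
  obtains c j where "a = c ^ l * M ^ j"
proof -
  have "twist zetaK (y ^ l mod h) = twist zetaK ([:a:] mod h)"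
    using y_root(1) by (simp add: cong_def)
  then have "[twist zetaK y ^ l = [:a:]] (mod h)"
    using twist_mod[of zetaK h] twist_zetaK_h[of 1] by (simp add: cong_def twist_power)
  then have "[twist zetaK y ^ l = y ^ l] (mod h)" using y_root(1) by (meson cong_sym cong_trans)
  then obtain j where eigenvector: "j < l" "twist zetaK y = smult (zetaK ^ j) y"
    using power_cong_imp_root_of_unity_multiple[of "twist zetaK y" y] y_root(2) by auto
  have "coeff y i = 0" if "i \<noteq> j" for i
  proof (cases "i < l")
    case True
    have "zetaK ^ i * coeff y i = zetaK ^ j * coeff y i"
      using eigenvector(2) by (metis coeff_smult coeff_twist)
    moreover have "zetaK ^ i \<noteq> zetaK ^ j"
      using inj_on_zetaK_power that True eigenvector(1) by (auto dest: inj_onD)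
    ultimately show ?thesis by simp
  qed (use y_root(2) in \<open>auto simp: coeff_eq_0\<close>)
  then have "y = monom (coeff y j) j" by (intro poly_eqI) auto
  then have "y ^ l = monom (coeff y j ^ l) (j * l)" by (metis monom_power)
  then have "y ^ l mod h = [:coeff y j ^ l * M ^ j:]" by (simp add: monom_mod_h monom_0)
  moreover have "[:a:] mod h = [:a:]" by (simp add: mod_h_id)
  ultimately show thesis using y_root(1) by (intro that[of "coeff y j" j]) (simp add: cong_def)
qed

lemma not_ext_iso_if_not_dvd:
  assumes "irreducible m1" "\<not> m1 dvd m"
  shows "\<not> ext_iso (kummer_poly l (to_fract m1)) h"
proof
  assume "ext_iso (kummer_poly l (to_fract m1)) h"
  then obtain \<phi> where hom: "\<phi> \<in> ring_hom (Kring (kummer_poly l (to_fract m1))) (Kring h)"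
      "\<And>c. \<phi> [:c:] = [:c:]"
    by (auto simp: ext_iso_def ring_iso_def)
  have "[\<phi> [:0, 1:] ^ l = [:to_fract m1:]] (mod h)" using hom l_gt_1 by (rule Kring_hom_kummer_root)
  moreover have "degree (\<phi> [:0, 1:]) < l"
    using ring_hom_closed[OF hom(1), of "[:0, 1:]"] l_gt_1 by (simp add: Kset_def)
  ultimately obtain c j where "to_fract m1 = c ^ l * M ^ j" by (rule const_cong_power_imp_eq)
  then show False using irreducible_neq_power_mult_power[OF assms l_gt_1] by simp
qed

end

subsection \<open>The discriminant\<close>

lemma sum_permutations_monomial_matrix:
  fixes t :: "nat \<Rightarrow> nat \<Rightarrow> 'b::comm_ring_1"
  assumes permutes: "\<rho> permutes {..<n}" and zero: "\<And>i j. i < n \<Longrightarrow> j < n \<Longrightarrow> j \<noteq> \<rho> i \<Longrightarrow> t i j = 0"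
  shows "(\<Sum>\<pi> | \<pi> permutes {..<n}. of_int (sign \<pi>) * (\<Prod>i<n. t i (\<pi> i)))
    = of_int (sign \<rho>) * (\<Prod>i<n. t i (\<rho> i))"
proof -
  have "(\<Prod>i<n. t i (\<pi> i)) = 0" if other_permutation: "\<pi> permutes {..<n}" "\<pi> \<noteq> \<rho>" for \<pi>
  proof -
    obtain i where differs: "\<pi> i \<noteq> \<rho> i" using other_permutation(2) by blast
    then have "i < n" using other_permutation(1) permutes by (metis lessThan_iff permutes_not_in)
    moreover from this have "\<pi> i < n" using permutes_in_image[OF other_permutation(1), of i] by simp
    ultimately show ?thesis using zero differs by (auto intro!: prod_zero bexI[of _ i])
  qed
  then have "(\<Sum>\<pi> | \<pi> permutes {..<n}. of_int (sign \<pi>) * (\<Prod>i<n. t i (\<pi> i))) =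
      (\<Sum>\<pi>\<in>{\<rho>}. of_int (sign \<pi>) * (\<Prod>i<n. t i (\<pi> i)))"
    using permutes by (intro sum.mono_neutral_right) (auto simp: finite_permutations)
  then show ?thesis by simp
qed

definition neg_mod :: "nat \<Rightarrow> nat \<Rightarrow> nat" where
  "neg_mod n i = (if i < n then (n - i) mod n else i)"

lemma neg_mod_permutes: "neg_mod n permutes {..<n}"
proof (rule inj_imp_permutes)
  have "neg_mod n (neg_mod n i) = i" for i by (cases "i = 0") (auto simp: neg_mod_def)
  then show "inj_on (neg_mod n) {..<n}" by (rule inj_on_inverseI)
qed (auto simp: neg_mod_def)

lemma dvd_add_iff_eq_neg_mod:
  assumes "i < n" "j < n"
  shows "n dvd i + j \<longleftrightarrow> j = neg_mod n i"
proof (cases "i = 0")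
  case True
  with assms show ?thesis by (auto simp: neg_mod_def dest: dvd_imp_le)
next
  case False
  have "i + j = n" if "n dvd i + j"
  proof -
    obtain k where multiple: "i + j = n * k" using \<open>n dvd i + j\<close> ..
    then have "n * k < n * 2" using assms by linarith
    then have "k = 1" using multiple False by (cases k) auto
    with multiple show ?thesis by simp
  qed
  with assms False show ?thesis by (auto simp: neg_mod_def)
qed

lemma neg_mod_less: "i < n \<Longrightarrow> neg_mod n i < n"
  by (simp add: neg_mod_def)

lemma add_neg_mod_div: "i < n \<Longrightarrow> (i + neg_mod n i) div n = (if i = 0 then 0 else 1)"
  by (simp add: neg_mod_def)

context kummer
begin

lemma Ktrace_monom:
  assumes "k < l"
  shows "Ktrace h (monom c k) = (if k = 0 then of_nat l * c else 0)"
proof -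
  have "coeff ((monom c k * monom 1 i) mod h) i = (if k = 0 then c else 0)" if "i < l" for i
  proof -
    have "[k + i = 0 + i] (mod l) \<longleftrightarrow> [k = 0] (mod l)" by (rule cong_add_rcancel_nat)
    then have "(k + i) mod l = i \<longleftrightarrow> k = 0" using that assms by (simp add: cong_def)
    then show ?thesis using that by (auto simp: mult_monom monom_mod_h)
  qed
  then show ?thesis by (simp add: Ktrace_def)
qed

lemma Ktrace_monom_mult:
  assumes "i < l" "j < l"
  shows "Ktrace h ((monom 1 i * monom 1 j) mod h) =
    (if j = neg_mod l i then to_fract (of_nat l * m ^ ((i + j) div l)) else 0)"
  using dvd_add_iff_eq_neg_mod[OF assms]
  by (simp add: mult_monom monom_mod_h Ktrace_monom dvd_eq_mod_eq_0)

lemma Kdisc_power_basis: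
  "Kdisc h (\<lambda>i. monom 1 i) = to_fract (of_int (sign (neg_mod l)) * (of_nat l ^ l * m ^ (l - 1)))"
proof -
  let ?t = "\<lambda>i j. Ktrace h ((monom 1 i * monom 1 j) mod h)"
  have of_int_sign: "of_int (sign (neg_mod l)) = to_fract (of_int (sign (neg_mod l)) :: 'a poly)"
    by (cases "neg_mod l" rule: sign_cases) simp_all
  obtain k where l_Suc: "l = Suc k" using l_gt_0 gr0_implies_Suc by blast
  have "Kdisc h (\<lambda>i. monom 1 i) = (\<Sum>\<pi> | \<pi> permutes {..<l}. of_int (sign \<pi>) * (\<Prod>i<l. ?t i (\<pi> i)))"
    by (simp add: Kdisc_def)
  also have "\<dots> = of_int (sign (neg_mod l)) * (\<Prod>i<l. ?t i (neg_mod l i))"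
    by (rule sum_permutations_monomial_matrix[OF neg_mod_permutes]) (simp add: Ktrace_monom_mult)
  also have "(\<Prod>i<l. ?t i (neg_mod l i)) = (\<Prod>i<l. to_fract (of_nat l * m ^ (if i = 0 then 0 else 1)))"
    by (rule prod.cong) (simp_all add: Ktrace_monom_mult neg_mod_less add_neg_mod_div)
  also have "\<dots> = to_fract (of_nat l ^ l * m ^ (l - 1))"
    by (simp add: l_Suc prod.lessThan_Suc_shift power_mult_distrib del: prod.lessThan_Suc)
  finally show ?thesis by (simp add: of_int_sign)
qed

lemma disc_coprime_h:
  assumes "\<not> m dvd g"
  shows "disc_coprime h g"
  unfolding disc_coprime_def
proof (intro allI impI notI, elim conjE)
  fix r assume prime_factor: "irreducible r" "r dvd g" and divides_all: "\<forall>d\<in>disc_gens h. r dvd d"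
  note prime = field_poly_irreducible_imp_prime[OF prime_factor(1)]
  let ?d = "of_int (sign (neg_mod l)) * (of_nat l ^ l * m ^ (l - 1))"
  have "monom 1 i \<in> OK h" if "i < l" for i
    using fract_poly_in_OK[of "monom 1 i"] that by (simp add: map_poly_monom degree_monom_eq)
  then have "?d \<in> disc_gens h"
    using Kdisc_power_basis
    by (auto simp: disc_gens_def to_fract_def intro!: exI[of _ "\<lambda>i. monom 1 i"])
  with divides_all have "r dvd of_nat l ^ l * m ^ (l - 1)"
    by (cases "neg_mod l" rule: sign_cases) auto
  then have "r dvd of_nat l \<or> r dvd m"
    using prime by (meson prime_elem_dvd_multD prime_elem_dvd_power)
  moreover have "\<not> r dvd m"
    using irreducible_m prime_factor assms by (meson dvd_trans irreducibleD' irreducible_not_unit)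
  moreover have "(of_nat l :: 'a poly) dvd 1"
    using finite_field_of_nat_neq_0[of l, where 'a='a] l_dvd
    by (simp add: q_eq of_nat_poly is_unit_pCons_iff)
  ultimately show False using prime_factor(1) by (meson dvd_trans irreducible_not_unit)
qed

end

section \<open>Infinitely many cyclic extensions\<close>

lemma inert_kummer_parameterE:
  fixes p :: "'a::{field,finite} poly"
  assumes "prime l" "l dvd CARD('a) - 1" "irreducible p"
  obtains m where "kummer_inert m l CARD('a) p" "degree m > d"
proof -
  let ?n = "CARD('a) ^ degree p - 1"
  have "l dvd ?n" using assms(2) minus_one_dvd_power_minus_one by (rule dvd_trans)
  with assms(3,1) obtain a where "\<not> p dvd a" "\<not> p dvd a ^ (?n div l) - 1"
    by (rule power_nonresidueE)
  with assms(3) obtain m where "irreducible m" "degree m > d" "\<not> p dvd m" "\<not> p dvd m ^ (?n div l) - 1"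
    by (rule large_irreducible_power_nonresidueE)
  with assms that[of m] show thesis
    by (simp add: kummer_inert_def kummer_inert_axioms_def kummer_def)
qed

lemma infinite_inert_kummer_parametersE:
  fixes p g :: "'a::{field,finite} poly"
  assumes "prime l" "l dvd CARD('a) - 1" "irreducible p" "g \<noteq> 0"
  obtains P where "infinite P" "\<And>m. m \<in> P \<Longrightarrow> kummer_inert m l CARD('a) p"
    "\<And>m. m \<in> P \<Longrightarrow> \<not> m dvd g" "\<And>m1 m2. m1 \<in> P \<Longrightarrow> m2 \<in> P \<Longrightarrow> m1 \<noteq> m2 \<Longrightarrow> \<not> m1 dvd m2"
proof -
  let ?S = "{m. kummer_inert m l CARD('a) p \<and> degree m > degree g}"
  have "\<exists>m\<in>?S. degree m > n" for n
    using inert_kummer_parameterE[OF assms(1-3), of "max (degree g) n"]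
    by (metis (mono_tags, lifting) max_less_iff_conj mem_Collect_eq)
  then have "infinite (degree ` ?S)" unfolding infinite_nat_iff_unbounded by blast
  moreover obtain P where P_subset: "P \<subseteq> ?S" and inj: "inj_on degree P" and "degree ` ?S = degree ` P"
    using subset_image_inj[of "degree ` ?S" degree ?S] by blast
  ultimately have "infinite P" by auto
  moreover have inert: "kummer_inert m l CARD('a) p" "\<not> m dvd g" if "m \<in> P" for m
  proof -
    show "kummer_inert m l CARD('a) p" using that P_subset by blast
    have "degree g < degree m" using that P_subset by blast
    then show "\<not> m dvd g" using dvd_imp_degree_le[OF _ assms(4)] by fastforce
  qed
  moreover have "\<not> m1 dvd m2" if "m1 \<in> P" "m2 \<in> P" "m1 \<noteq> m2" for m1 m2
    using irreducible_dvd_imp_degree_eq[of m1 m2] inj_onD[OF inj] that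
      inert(1)[THEN kummer_inert.axioms(1), THEN kummer.irreducible_m] by blast
  ultimately show thesis by (rule that)
qed

lemma carmichael_poly_obstructionE:
  fixes g :: "'a::{field,finite} poly"
  assumes "degree g > 0" "squarefree g" "\<not> carmichael_poly g"
  obtains p where "irreducible p" "p dvd g" "g = p \<or> \<not> degree p dvd degree g"
  using korselt_carmichael_poly[OF assms(1,2)] assms(3)
  by (cases "irreducible g") (blast intro: dvd_refl)+

theorem theorem5p6:
  fixes g :: "'a::{field,finite} poly" and l :: nat
  assumes "card (UNIV :: 'a set) \<ge> 3"
    and "degree g > 0" and "squarefree g" and "\<not> carmichael_poly g"
    and "prime l" and "l dvd card (UNIV :: 'a set) - 1"
  shows "\<exists>H :: 'a poly fract poly set. infinite H \<and>
           (\<forall>h\<in>H. cyclic_ext l h \<and> disc_coprime h g \<and> \<not> carmichael_in h g) \<and>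
           (\<forall>h1\<in>H. \<forall>h2\<in>H. h1 \<noteq> h2 \<longrightarrow> \<not> ext_iso h1 h2)"
proof -
  obtain p where obstruction: "irreducible p" "p dvd g" "g = p \<or> \<not> degree p dvd degree g"
    using assms(2-4) by (rule carmichael_poly_obstructionE)
  have "g \<noteq> 0" using assms(2) by auto
  with assms(5,6) obstruction(1) obtain P where "infinite P"
    and inert: "\<And>m. m \<in> P \<Longrightarrow> kummer_inert m l CARD('a) p"
    and coprime: "\<And>m. m \<in> P \<Longrightarrow> \<not> m dvd g"
    and distinct: "\<And>m1 m2. m1 \<in> P \<Longrightarrow> m2 \<in> P \<Longrightarrow> m1 \<noteq> m2 \<Longrightarrow> \<not> m1 dvd m2"
    by (rule infinite_inert_kummer_parametersE) blast
  let ?h = "\<lambda>m. kummer_poly l (to_fract m)"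
  have "inj_on ?h P" by (auto simp: inj_on_def kummer_poly_eq_iff)
  with \<open>infinite P\<close> have "infinite (?h ` P)" by (simp add: finite_image_iff)
  moreover have "cyclic_ext l (?h m) \<and> disc_coprime (?h m) g \<and> \<not> carmichael_in (?h m) g"
    if "m \<in> P" for m
  proof -
    interpret kummer_inert m l "CARD('a)" p using that by (rule inert)
    show ?thesis
      using cyclic_ext_h disc_coprime_h[OF coprime[OF that]]
        not_carmichael_in[OF obstruction(2) assms(2) obstruction(3)]
      by blast
  qed
  moreover have "\<not> ext_iso (?h m1) (?h m2)" if "m1 \<in> P" "m2 \<in> P" "m1 \<noteq> m2" for m1 m2
    using kummer_inert.not_ext_iso_if_not_dvd[OF inert[OF that(2)] _ distinct[OF that]]
      kummer.irreducible_m[OF kummer_inert.axioms(1)[OF inert[OF that(1)]]] .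
  ultimately show ?thesis by (intro exI[of _ "?h ` P"]) auto
qed

end
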